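(* Let $\lambda_0>0$ and let $\mathbf x=\mathbf x(s,\lambda)\in\mathbb R^3$ and $\mathbf y=\mathbf y(t,\lambda)\in\mathbb R^3$, $\lambda\in[0,\lambda_0]$, be families of curves, where $s$ is the arc length along $\mathbf x(\cdot,\lambda)$ and $\mathbf y(t+1,\lambda)=\mathbf y(t,\lambda)$ for all $t$. Put $\mathbf z(s,t,\lambda)=\mathbf x(s,\lambda)-\mathbf y(t,\lambda)$, $\delta(\lambda)=\min_{s,t}|\mathbf z(s,t,\lambda)|$, and, for $\lambda\in(0,\lambda_0]$, $U(s,t,\lambda)=-|\mathbf z(s,t,\lambda)|^{-1}$, with $'=\partial/\partial s$. Assume: (1) $|\mathbf z(0,0,\lambda)|=\delta(\lambda)$ for all $\lambda\in[0,\lambda_0]$, with $\delta(\lambda)>0$ for $\lambda\in(0,\lambda_0]$; (2) $\frac{\partial^2}{\partial t^2}|\mathbf z(0,t,\lambda)|\big|_{t=0}\neq 0$ for $\lambda\in(0,\lambda_0]$; (3) $\frac{\partial \mathbf x}{\partial s}(0,\lambda)\cdot\frac{\partial\mathbf y}{\partial t}(0,\lambda)=0$ for all $\lambda\in[0,\lambda_0]$; (4) $\mathbf x$ and $\mathbf y$ are bounded in the $C^2$-norm (in $s$ and in $t$, respectively) uniformly in $\lambda$; (5) $\delta(\lambda)\to0$ as $\lambda\to0$; (6) $s=0$ is an equilibrium of the equation $\ddot s+U'(s,t,\lambda)=0$ for every $\lambda\in(0,\lambda_0]$, i.e. $U'(0,t,\lambda)=0$ for all $t$, and $a(t,\lambda):=U''(0,t,\lambda)$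 is continuous in $(t,\lambda)$ for $\lambda\in(0,\lambda_0]$. Then there exists an infinite sequence $$\lambda_1>\lambda_2\ge\lambda_3>\lambda_4\ge\cdots>\lambda_{2n-1}>\lambda_{2n}\ge\cdots\to0$$ such that the equilibrium solution $s=0$ of $\ddot s+U'(s,t,\lambda)=0$ is linearly strongly stable for all $\lambda\in(\lambda_{2n},\lambda_{2n-1})$, $n\ge1$. Furthermore, each complementary $\lambda$-interval $[\lambda_{2n+1},\lambda_{2n}]$, $n\ge 1$, contains points where the linearized equilibrium is not strongly stable, i.e. is either hyperbolic or parabolic.
   Context: The linearization of $\ddot s+U'(s,t,\lambda)=0$ at $s=0$ is $\ddot S+a(t,\lambda)S=0$ with $a(t,\lambda)=U''(0,t,\lambda)$, which satisfies $a(t+1,\lambda)=a(t,\lambda)$. Its Floquet multipliers are the eigenvalues of the period-1 monodromy (Floquet) matrix of the first-order system for $(S,\dot S)$. The equilibrium $s=0$ is linearly strongly stable if the Floquet multipliers lie on the unit circle and are not real (equivalently, the linearized system lies in the interior of the set of stable systems). It is parabolic if both multipliers equal $1$ or both equal $-1$, and hyperbolic if the multipliers are real with modulus different from $1$. *)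

theory Defs
  imports "HOL-Analysis.Analysis"
begin

text \<open>
  Throughout, \<open>l\<close> is the parameter of the families of curves \<open>x s l\<close> and \<open>y t l\<close>.
\<close>

definition separation ::
    "(real \<Rightarrow> real \<Rightarrow> real^3) \<Rightarrow> (real \<Rightarrow> real \<Rightarrow> real^3) \<Rightarrow> real \<Rightarrow> real \<Rightarrow> real \<Rightarrow> real^3" where
  "separation x y s t l = x s l - y t l"

text \<open>
  The infimum over the parameter interval \<open>I\<close> of the first curve and all times \<open>t\<close>. It is a
  minimum as soon as it is attained, in particular if it equals the distance at \<open>s = t = 0\<close>.
\<close>

definition min_distance ::
    "real set \<Rightarrow> (real \<Rightarrow> real \<Rightarrow> real^3) \<Rightarrow> (real \<Rightarrow> real \<Rightarrow> real^3) \<Rightarrow> real \<Rightarrow> real" where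
  "min_distance I x y l = (INF (s, t) \<in> I \<times> UNIV. norm (separation x y s t l))"

definition potential ::
    "(real \<Rightarrow> real \<Rightarrow> real^3) \<Rightarrow> (real \<Rightarrow> real \<Rightarrow> real^3) \<Rightarrow> real \<Rightarrow> real \<Rightarrow> real \<Rightarrow> real" where
  "potential x y s t l = - inverse (norm (separation x y s t l))"

definition linear_coeff ::
    "(real \<Rightarrow> real \<Rightarrow> real^3) \<Rightarrow> (real \<Rightarrow> real \<Rightarrow> real^3) \<Rightarrow> real \<Rightarrow> real \<Rightarrow> real" where
  "linear_coeff x y t l = (deriv ^^ 2) (\<lambda>s. potential x y s t l) 0"

text \<open>The derivatives are two-sided, so this is meant for open \<open>I\<close>.\<close>

definition C2_bounded_on ::
    "real set \<Rightarrow> (real \<Rightarrow> 'a::real_normed_vector) \<Rightarrow> real \<Rightarrow> bool" where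
  "C2_bounded_on I f B \<longleftrightarrow>
     (\<exists>f' f''.
        (\<forall>s\<in>I. (f has_vector_derivative f' s) (at s)) \<and>
        (\<forall>s\<in>I. (f' has_vector_derivative f'' s) (at s)) \<and>
        continuous_on I f'' \<and>
        (\<forall>s\<in>I. norm (f s) \<le> B \<and> norm (f' s) \<le> B \<and> norm (f'' s) \<le> B))"

text \<open>
  The equation \<open>S'' + a(t) S = 0\<close>, with \<open>a\<close> of period 1, as a first-order system
  for the column vector \<open>(S, S')\<close>.
\<close>

definition hill_matrix :: "(real \<Rightarrow> real) \<Rightarrow> real \<Rightarrow> real^2^2" where
  "hill_matrix a t = vector [vector [0, 1], vector [- a t, 0]]"

definition fundamental_solution :: "(real \<Rightarrow> real) \<Rightarrow> (real \<Rightarrow> real^2^2) \<Rightarrow> bool" where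
  "fundamental_solution a \<Phi> \<longleftrightarrow>
     \<Phi> 0 = mat 1 \<and>
     (\<forall>t\<in>{0..1}. (\<Phi> has_vector_derivative (hill_matrix a t ** \<Phi> t)) (at t within {0..1}))"

text \<open>For continuous \<open>a\<close> the fundamental solution on \<open>[0,1]\<close> exists and is unique.\<close>

definition monodromy :: "(real \<Rightarrow> real) \<Rightarrow> real^2^2" where
  "monodromy a = (THE M. \<exists>\<Phi>. fundamental_solution a \<Phi> \<and> M = \<Phi> 1)"

definition complex_matrix :: "real^'n^'m \<Rightarrow> complex^'n^'m" where
  "complex_matrix M = (\<chi> i j. complex_of_real (M $ i $ j))"

definition floquet_multipliers :: "(real \<Rightarrow> real) \<Rightarrow> complex set" where
  "floquet_multipliers a =
     {\<mu>. \<exists>v. v \<noteq> 0 \<and> complex_matrix (monodromy a) *v v = \<mu> *s v}"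

definition strongly_stable :: "(real \<Rightarrow> real) \<Rightarrow> bool" where
  "strongly_stable a \<longleftrightarrow> (\<forall>\<mu>\<in>floquet_multipliers a. cmod \<mu> = 1 \<and> \<mu> \<notin> \<real>)"

text \<open>The set of eigenvalues is a singleton exactly if the two multipliers coincide.\<close>

definition parabolic :: "(real \<Rightarrow> real) \<Rightarrow> bool" where
  "parabolic a \<longleftrightarrow> floquet_multipliers a = {1} \<or> floquet_multipliers a = {-1}"

definition hyperbolic :: "(real \<Rightarrow> real) \<Rightarrow> bool" where
  "hyperbolic a \<longleftrightarrow> (\<forall>\<mu>\<in>floquet_multipliers a. \<mu> \<in> \<real> \<and> cmod \<mu> \<noteq> 1)"

end

theory Submission
  imports Defs
begin

text \<open>
  The proof follows the rotation of solutions of \<open>S'' + a(t) S = 0\<close> in the phase plane. On the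
  equilibrium, \<open>a = (1 + z \<bullet> x'') / |z|\<^sup>3\<close>, and \<open>|z|\<close> is of the order of the minimal distance \<open>\<delta>\<close>
  for a time of order \<open>\<delta>\<close>, because the speed of \<open>y\<close> is bounded. There \<open>a\<close> is of order \<open>\<delta>\<^sup>-\<^sup>3\<close>
  (\<open>linear_coeff_near_collision\<close>), so solutions rotate at a rate \<open>\<delta>\<^sup>-\<^sup>3\<^sup>/\<^sup>2\<close> and through a total angle of
  order \<open>\<delta>\<^sup>-\<^sup>1\<^sup>/\<^sup>2\<close> (\<open>prufer_angle_ge\<close>). Elsewhere \<open>a\<close> may be negative, but a solution always crosses
  the axis \<open>S = 0\<close> in the same direction, and at most half a turn can be undone
  (\<open>prufer_angle_stays_above\<close>). Hence the angle by which the solution starting at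
  \<open>(S, S') = (0, 1)\<close> turns in one period, a continuous function of the parameter, tends to infinity
  as the parameter tends to 0.

  Whenever this angle is a multiple \<open>k \<pi>\<close>, the vector \<open>(0, 1)\<close> is an eigenvector of the monodromy
  matrix. The determinant is 1, so the trace is \<open>(-1)^k (r + 1 / r)\<close> with \<open>r > 0\<close>: it is at least 2 for
  even \<open>k\<close> and at most \<open>-2\<close> for odd \<open>k\<close> (\<open>trace_monodromy_half_turns\<close>). As the parameter decreases to 0
  the trace therefore traverses the band \<open>(-2, 2)\<close> infinitely often. Each traversal contains an
  interval on which the trace is in the band, so that the system is strongly stable, with trace
  \<open>\<plusminus>2\<close> at the left end, where it is parabolic (\<open>stable_window\<close>). Such intervals, chosen one to the left
  of the other, make up the sequence; the left end \<open>L (2 n)\<close> is itself the point of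
  \<open>[L (2 n + 1), L (2 n)]\<close> that is not strongly stable.

  The angle satisfies a scalar differential equation with bounded Lipschitz constant, and the
  linear solutions can be recovered from it by a quadrature (\<open>prufer_hill_solution\<close>). Existence
  and continuity in the parameter of both the angle and the trace thus come from one Picard
  theorem, applied to a scalar equation (\<open>picard_lindelof_param\<close>).
\<close>

section \<open>Ordinary differential equations with a parameter\<close>

lemma integral_upto_rescale:
  fixes g :: "real \<Rightarrow> 'b::banach"
  assumes "t \<ge> 0" "continuous_on {0..t} g"
  shows "integral {0..t} g = t *\<^sub>R integral {0..1} (\<lambda>\<sigma>. g (t * \<sigma>))"
proof (cases "t = 0")
  case False
  with \<open>t \<ge> 0\<close> have "t > 0" by simp
  have "integral ((\<lambda>x. x / t) ` {0..t}) (\<lambda>x. g (t * x)) = (1 / \<bar>t\<bar>) *\<^sub>R integral {0..t} g"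
    using \<open>t > 0\<close> integrable_continuous_real[OF assms(2)] by (intro integral_stretch_real) auto
  moreover have "(\<lambda>x. x / t) ` {0..t} = {0..1}"
    using \<open>t > 0\<close> by (simp add: image_divide_atLeastAtMost)
  ultimately show ?thesis
    using \<open>t > 0\<close> by simp
qed auto

text \<open>
  Rescaling moves the variable upper limit into the integrand, and continuity of parametric
  integrals over the fixed interval \<open>[0, 1]\<close> applies.
\<close>
lemma continuous_on_integral_upto_param:
  fixes g :: "real \<Rightarrow> 'p::topological_space \<Rightarrow> 'b::banach"
  assumes "continuous_on ({0..1} \<times> P) (\<lambda>(s, p). g s p)"
  shows "continuous_on ({0..1} \<times> P) (\<lambda>(t, p). integral {0..t} (\<lambda>s. g s p))"
proof -
  have "continuous_on (({0..1} \<times> P) \<times> cbox 0 1) (\<lambda>(z, \<sigma>). g (fst z * \<sigma>) (snd z))"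
    unfolding split_beta
    by (rule continuous_on_compose2[OF assms, of _ "\<lambda>w. (fst (fst w) * snd w, snd (fst w))", simplified])
       (auto intro!: continuous_intros mult_le_one)
  from integral_continuous_on_param[OF this]
  have "continuous_on ({0..1} \<times> P)
      (\<lambda>z. fst z *\<^sub>R integral {0..1} (\<lambda>\<sigma>. g (fst z * \<sigma>) (snd z)))"
    by (auto intro!: continuous_intros)
  also have "?this \<longleftrightarrow> ?thesis"
  proof (rule continuous_on_cong[OF refl])
    fix z :: "real \<times> 'p" assume "z \<in> {0..1} \<times> P"
    then obtain t p where z: "z = (t, p)" "0 \<le> t" "t \<le> 1" "p \<in> P" by auto
    have "continuous_on {0..t} (\<lambda>s. g s p)"
      by (rule continuous_on_compose2[OF assms, of _ "\<lambda>s. (s, p)", simplified])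
         (use z in \<open>auto intro!: continuous_intros\<close>)
    from integral_upto_rescale[OF \<open>0 \<le> t\<close> this]
    show "fst z *\<^sub>R integral {0..1} (\<lambda>\<sigma>. g (fst z * \<sigma>) (snd z))
        = (case z of (t, p) \<Rightarrow> integral {0..t} (\<lambda>s. g s p))"
      by (simp add: z)
  qed
  finally show ?thesis .
qed

primrec picard :: "(real \<Rightarrow> 'p \<Rightarrow> 'b \<Rightarrow> 'b::banach) \<Rightarrow> 'b \<Rightarrow> nat \<Rightarrow> real \<Rightarrow> 'p \<Rightarrow> 'b" where
  "picard f u0 0 = (\<lambda>t p. u0)"
| "picard f u0 (Suc n) = (\<lambda>t p. u0 + integral {0..t} (\<lambda>s. f s p (picard f u0 n s p)))"

text \<open>
  The inductive step in the estimate of consecutive Picard iterates: each integration trades a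
  power of the time for the next power divided by its exponent, which produces the factorials.
\<close>
lemma picard_step_bound:
  fixes g h :: "real \<Rightarrow> 'b::banach"
  assumes "continuous_on {0..t} g" "continuous_on {0..t} h" "t \<ge> 0"
    and "\<And>s. s \<in> {0..t} \<Longrightarrow> norm (g s - h s) \<le> c * s ^ n"
  shows "norm (integral {0..t} g - integral {0..t} h) \<le> c * (t ^ Suc n / Suc n)"
proof -
  have i: "g integrable_on {0..t}" "h integrable_on {0..t}"
    using assms by (auto intro: integrable_continuous_real)
  have "norm (integral {0..t} (\<lambda>s. g s - h s)) \<le> integral {0..t} (\<lambda>s. c * s ^ n)"
    using assms
    by (intro integral_norm_bound_integral)
       (auto intro!: integrable_continuous_real continuous_intros)
  also have "integral {0..t} (\<lambda>s. c * s ^ n) = c * (t ^ Suc n / Suc n)"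
  proof (rule integral_unique)
    have "((\<lambda>s. c * (s ^ Suc n / Suc n)) has_real_derivative c * s ^ n) (at s within {0..t})" for s
      using DERIV_cmult[OF DERIV_cdivide[OF DERIV_pow[of "Suc n" s "{0..t}"]], of c "Suc n"] by simp
    then have "((\<lambda>s. c * s ^ n) has_integral c * (t ^ Suc n / Suc n) - c * (0 ^ Suc n / Suc n)) {0..t}"
      by (intro fundamental_theorem_of_calculus[OF assms(3)])
         (simp add: has_real_derivative_iff_has_vector_derivative)
    then show "((\<lambda>s. c * s ^ n) has_integral c * (t ^ Suc n / Suc n)) {0..t}" by simp
  qed
  finally show ?thesis
    using i by (simp add: integral_diff)
qed

text \<open>
  Carrying the parameter through the Picard iteration, instead of solving for each parameter
  separately, makes the continuous dependence of the solution on the parameter a by-product of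
  the uniform convergence.
\<close>
proposition picard_lindelof_param:
  fixes f :: "real \<Rightarrow> 'p::topological_space \<Rightarrow> 'b::banach \<Rightarrow> 'b"
  assumes cont: "continuous_on ({0..1} \<times> P \<times> UNIV) (\<lambda>(t, p, u). f t p u)"
    and lip: "\<And>t p u v. t \<in> {0..1} \<Longrightarrow> p \<in> P \<Longrightarrow> norm (f t p u - f t p v) \<le> K * norm (u - v)"
    and bound: "\<And>t p. t \<in> {0..1} \<Longrightarrow> p \<in> P \<Longrightarrow> norm (f t p u0) \<le> C"
    and "K \<ge> 0"
  obtains u where "continuous_on ({0..1} \<times> P) (\<lambda>(t, p). u t p)"
    and "\<And>p. u 0 p = u0"
    and "\<And>t p. t \<in> {0..1} \<Longrightarrow> p \<in> P \<Longrightarrow>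
           ((\<lambda>t. u t p) has_vector_derivative f t p (u t p)) (at t within {0..1})"
proof -
  define U where "U = picard f u0"
  have f_comp: "continuous_on ({0..1} \<times> P) (\<lambda>(s, p). f s p (w s p))"
    if "continuous_on ({0..1} \<times> P) (\<lambda>(s, p). w s p)" for w
    using that unfolding split_beta
    by (intro continuous_on_compose2[OF cont, of _ "\<lambda>z. (fst z, snd z, w (fst z) (snd z))", simplified])
       (auto intro!: continuous_intros)
  have slice: "continuous_on {0..t} (\<lambda>s. w s p)"
    if "continuous_on ({0..1} \<times> P) (\<lambda>(s, p). w s p)" "t \<le> 1" "p \<in> P"
    for w :: "real \<Rightarrow> 'p \<Rightarrow> 'b" and t p
    by (rule continuous_on_compose2[OF that(1), of _ "\<lambda>s. (s, p)", simplified])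
       (use that in \<open>auto intro!: continuous_intros\<close>)
  have U_cont: "continuous_on ({0..1} \<times> P) (\<lambda>(t, p). U n t p)" for n
  proof (induction n)
    case 0
    show ?case by (simp add: U_def)
  next
    case (Suc n)
    from continuous_on_integral_upto_param[OF f_comp[OF Suc]]
    show ?case
      by (auto simp: U_def split_beta intro!: continuous_intros)
  qed
  define M where "M n = C * (K ^ n / fact n)" for n
  have step: "norm (U (Suc n) t p - U n t p) \<le> M n * t ^ n"
    if "t \<in> {0..1}" "p \<in> P" for n t p
    using that(1)
  proof (induction n arbitrary: t)
    case 0
    have "norm (integral {0..t} (\<lambda>s. f s p u0) - integral {0..t} (\<lambda>s. 0)) \<le> C * (t ^ Suc 0 / Suc 0)"
      using 0 \<open>p \<in> P\<close> bound slice[OF U_cont[of 0]] slice[OF f_comp[OF U_cont[of 0]]]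
      by (intro picard_step_bound) (auto simp: U_def)
    moreover have "C * t \<le> C * 1"
      using 0 bound[OF 0 \<open>p \<in> P\<close>] by (intro mult_left_mono) (auto intro: order_trans[OF norm_ge_zero])
    ultimately show ?case by (simp add: U_def M_def)
  next
    case (Suc n)
    have "norm (f s p (U (Suc n) s p) - f s p (U n s p)) \<le> (K * M n) * s ^ n" if "s \<in> {0..t}" for s
    proof -
      have s: "s \<in> {0..1}" using that Suc.prems by auto
      have "norm (f s p (U (Suc n) s p) - f s p (U n s p)) \<le> K * norm (U (Suc n) s p - U n s p)"
        by (rule lip[OF s \<open>p \<in> P\<close>])
      also have "\<dots> \<le> K * (M n * s ^ n)"
        by (rule mult_left_mono[OF Suc.IH[OF s] \<open>K \<ge> 0\<close>])
      finally show ?thesis by (simp add: mult_ac)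
    qed
    then have "norm (integral {0..t} (\<lambda>s. f s p (U (Suc n) s p)) - integral {0..t} (\<lambda>s. f s p (U n s p)))
        \<le> (K * M n) * (t ^ Suc n / Suc n)"
      using Suc.prems \<open>p \<in> P\<close>
      by (intro picard_step_bound slice[OF f_comp[OF U_cont]]) auto
    moreover have "U (Suc (Suc n)) t p - U (Suc n) t p =
        integral {0..t} (\<lambda>s. f s p (U (Suc n) s p)) - integral {0..t} (\<lambda>s. f s p (U n s p))"
      by (simp add: U_def)
    moreover have "(K * M n) * (t ^ Suc n / Suc n) = M (Suc n) * t ^ Suc n"
      by (simp add: M_def field_simps)
    ultimately show ?case by simp
  qed
  have "summable M"
    unfolding M_def using summable_exp[of K] by (intro summable_mult) (simp add: field_simps)
  have M_bound: "norm ((\<lambda>(t, p). U (Suc n) t p - U n t p) z) \<le> M n" if z_in: "z \<in> {0..1} \<times> P" for n z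
  proof -
    obtain t p where z: "z = (t, p)" "t \<in> {0..1}" "p \<in> P"
      using z_in by (elim SigmaE) blast
    have "C \<ge> 0" using bound[OF z(2,3)] by (auto intro: order_trans[OF norm_ge_zero])
    then have "M n \<ge> 0" using \<open>K \<ge> 0\<close> by (simp add: M_def)
    then have "M n * t ^ n \<le> M n * 1" using z by (intro mult_left_mono) (auto simp: power_le_one)
    with step[OF z(2,3), of n] show ?thesis by (simp add: z)
  qed
  \<comment> \<open>The iterates converge uniformly because they are the partial sums of a telescoping series
      dominated by the exponential series of \<open>K\<close>.\<close>
  define u where "u t p = u0 + (\<Sum>n. U (Suc n) t p - U n t p)" for t p
  have "uniform_limit ({0..1} \<times> P) (\<lambda>n z. \<Sum>i<n. (\<lambda>(t, p). U (Suc i) t p - U i t p) z)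
      (\<lambda>z. suminf (\<lambda>i. (\<lambda>(t, p). U (Suc i) t p - U i t p) z)) sequentially"
    by (rule Weierstrass_m_test[OF M_bound \<open>summable M\<close>])
  then have "uniform_limit ({0..1} \<times> P)
      (\<lambda>n z. u0 + (\<Sum>i<n. (\<lambda>(t, p). U (Suc i) t p - U i t p) z))
      (\<lambda>z. u0 + suminf (\<lambda>i. (\<lambda>(t, p). U (Suc i) t p - U i t p) z)) sequentially"
    by (intro uniform_limit_intros)
  moreover have "(\<lambda>n z. u0 + (\<Sum>i<n. (\<lambda>(t, p). U (Suc i) t p - U i t p) z)) = (\<lambda>n (t, p). U n t p)"
  proof (intro ext)
    fix n and z :: "real \<times> 'p"
    have "(\<Sum>i<n. U (Suc i) (fst z) (snd z) - U i (fst z) (snd z)) = U n (fst z) (snd z) - u0"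
      by (subst sum_lessThan_telescope) (simp add: U_def)
    then show "u0 + (\<Sum>i<n. (\<lambda>(t, p). U (Suc i) t p - U i t p) z) = (\<lambda>(t, p). U n t p) z"
      by (simp add: split_beta)
  qed
  moreover have "(\<lambda>z. u0 + suminf (\<lambda>i. (\<lambda>(t, p). U (Suc i) t p - U i t p) z)) = (\<lambda>(t, p). u t p)"
    by (auto simp: fun_eq_iff u_def)
  ultimately have lim: "uniform_limit ({0..1} \<times> P) (\<lambda>n (t, p). U n t p) (\<lambda>(t, p). u t p) sequentially"
    by simp
  have u_cont: "continuous_on ({0..1} \<times> P) (\<lambda>(t, p). u t p)"
    by (rule uniform_limit_theorem[OF _ lim]) (simp_all add: U_cont)
  have u_eq: "u t p = u0 + integral {0..t} (\<lambda>s. f s p (u s p))"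
    if t: "t \<in> {0..1}" and p: "p \<in> P" for t p
  proof -
    have "uniform_limit {0..t} (\<lambda>n s. f s p (U n s p)) (\<lambda>s. f s p (u s p)) sequentially"
      unfolding uniform_limit_iff
    proof (intro allI impI)
      fix e :: real assume "e > 0"
      then have "e / (K + 1) > 0" using \<open>K \<ge> 0\<close> by simp
      with lim have "\<forall>\<^sub>F n in sequentially. \<forall>z\<in>{0..1} \<times> P.
          dist ((\<lambda>(t, p). U n t p) z) ((\<lambda>(t, p). u t p) z) < e / (K + 1)"
        unfolding uniform_limit_iff by blast
      then show "\<forall>\<^sub>F n in sequentially. \<forall>s\<in>{0..t}. dist (f s p (U n s p)) (f s p (u s p)) < e"
      proof (eventually_elim, intro ballI)
        fix n s
        assume close: "\<forall>z\<in>{0..1} \<times> P.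
            dist ((\<lambda>(t, p). U n t p) z) ((\<lambda>(t, p). u t p) z) < e / (K + 1)" and "s \<in> {0..t}"
        have s: "s \<in> {0..1}" using \<open>s \<in> {0..t}\<close> that by auto
        have "norm (f s p (U n s p) - f s p (u s p)) \<le> K * norm (U n s p - u s p)"
          by (rule lip[OF s \<open>p \<in> P\<close>])
        also have "\<dots> \<le> K * (e / (K + 1))"
          using close s \<open>p \<in> P\<close> \<open>K \<ge> 0\<close> by (intro mult_left_mono) (force simp: dist_norm)+
        also have "\<dots> < e" using \<open>K \<ge> 0\<close> \<open>e > 0\<close> by (simp add: field_simps)
        finally show "dist (f s p (U n s p)) (f s p (u s p)) < e" by (simp add: dist_norm)
      qed
    qed
    then obtain I J where IJ: "\<And>n. ((\<lambda>s. f s p (U n s p)) has_integral I n) {0..t}"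
        "((\<lambda>s. f s p (u s p)) has_integral J) {0..t}" "I \<longlonglongrightarrow> J"
      using t p by (elim uniform_limit_integral) (auto intro!: slice[OF f_comp[OF U_cont]])
    have "(\<lambda>n. U n t p) \<longlonglongrightarrow> u t p"
      using tendsto_uniform_limitI[OF lim, of "(t, p)"] that by simp
    then have "(\<lambda>n. U (Suc n) t p) \<longlonglongrightarrow> u t p"
      by (rule LIMSEQ_Suc)
    moreover have "U (Suc n) t p = u0 + I n" for n
      using integral_unique[OF IJ(1)[of n]] by (simp add: U_def)
    ultimately have "(\<lambda>n. u0 + I n) \<longlonglongrightarrow> u t p" by simp
    moreover have "(\<lambda>n. u0 + I n) \<longlonglongrightarrow> u0 + J" by (intro tendsto_intros IJ)
    ultimately have "u t p = u0 + J" by (rule LIMSEQ_unique)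
    with integral_unique[OF IJ(2)] show ?thesis by simp
  qed
  have "((\<lambda>t. u t p) has_vector_derivative f t p (u t p)) (at t within {0..1})"
    if "t \<in> {0..1}" "p \<in> P" for t p
  proof -
    have "((\<lambda>t. u0 + integral {0..t} (\<lambda>s. f s p (u s p))) has_vector_derivative 0 + f t p (u t p))
        (at t within {0..1})"
      using that
      by (intro has_vector_derivative_add has_vector_derivative_const integral_has_vector_derivative
           slice[OF f_comp[OF u_cont]]) auto
    then have d: "((\<lambda>t. u0 + integral {0..t} (\<lambda>s. f s p (u s p))) has_vector_derivative f t p (u t p))
        (at t within {0..1})" by simp
    show ?thesis
      by (rule has_vector_derivative_transform[OF that(1) _ d]) (use u_eq that in simp)
  qed
  moreover have "u 0 p = u0" for p
  proof -
    have "U n 0 p = u0" for n by (cases n) (simp_all add: U_def)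
    then show ?thesis by (simp add: u_def)
  qed
  ultimately show ?thesis
    using that u_cont by blast
qed

section \<open>Monodromy matrix and Floquet multipliers\<close>

lemma has_vector_derivative_vec_nth_iff:
  fixes f :: "real \<Rightarrow> 'a::real_normed_vector ^ 'n"
  shows "(f has_vector_derivative f') (at t within S) \<longleftrightarrow>
         (\<forall>i. ((\<lambda>t. f t $ i) has_vector_derivative f' $ i) (at t within S))"
proof
  assume "(f has_vector_derivative f') (at t within S)"
  then show "\<forall>i. ((\<lambda>t. f t $ i) has_vector_derivative f' $ i) (at t within S)"
    by (auto intro: bounded_linear.has_vector_derivative[OF bounded_linear_vec_nth])
next
  assume *: "\<forall>i. ((\<lambda>t. f t $ i) has_vector_derivative f' $ i) (at t within S)"
  have "((\<lambda>s. (f s - f t - (s - t) *\<^sub>R f') /\<^sub>R norm (s - t)) \<longlongrightarrow> 0) (at t within S)"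
    by (rule vec_tendstoI)
       (use * in \<open>simp add: has_vector_derivative_def has_derivative_within diff_diff_eq inverse_eq_divide\<close>)
  then show "(f has_vector_derivative f') (at t within S)"
    by (simp add: has_vector_derivative_def has_derivative_within bounded_linear_scaleR_left
          diff_diff_eq inverse_eq_divide)
qed

definition hill_solution :: "(real \<Rightarrow> real) \<Rightarrow> (real \<Rightarrow> real) \<Rightarrow> (real \<Rightarrow> real) \<Rightarrow> bool" where
  "hill_solution a u v \<longleftrightarrow>
     (\<forall>t\<in>{0..1}. (u has_real_derivative v t) (at t within {0..1}) \<and>
                 (v has_real_derivative - a t * u t) (at t within {0..1}))"

lemma fundamental_solution_iff:
  "fundamental_solution a \<Phi> \<longleftrightarrow>
     \<Phi> 0 = mat 1 \<and> (\<forall>j. hill_solution a (\<lambda>t. \<Phi> t $ 1 $ j) (\<lambda>t. \<Phi> t $ 2 $ j))"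
  unfolding fundamental_solution_def hill_solution_def hill_matrix_def
  by (simp add: has_vector_derivative_vec_nth_iff matrix_matrix_mult_def sum_2 forall_2
       has_real_derivative_iff_has_vector_derivative) blast

text \<open>
  Abel's identity: the system matrix has trace zero.
\<close>
lemma wronskian_constant:
  assumes "hill_solution a u v" "hill_solution a w z"
  shows "u 1 * z 1 - v 1 * w 1 = u 0 * z 0 - v 0 * w 0"
proof -
  have "((\<lambda>t. u t * z t - v t * w t) has_real_derivative 0) (at t within {0..1})"
    if "t \<in> {0..1}" for t
    using assms[unfolded hill_solution_def, rule_format, OF that]
    by (auto intro!: derivative_eq_intros simp: algebra_simps)
  then have "\<exists>c. \<forall>t\<in>{0..1}. u t * z t - v t * w t = c"
    by (intro has_field_derivative_zero_constant) auto
  then show ?thesis by force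
qed

lemma fundamental_solution_det:
  assumes "fundamental_solution a \<Phi>"
  shows "det (\<Phi> 1) = 1"
proof -
  have "\<Phi> 1 $ 1 $ 1 * \<Phi> 1 $ 2 $ 2 - \<Phi> 1 $ 2 $ 1 * \<Phi> 1 $ 1 $ 2 = 1"
    using assms wronskian_constant[of a "\<lambda>t. \<Phi> t $ 1 $ 1" "\<lambda>t. \<Phi> t $ 2 $ 1" "\<lambda>t. \<Phi> t $ 1 $ 2" "\<lambda>t. \<Phi> t $ 2 $ 2"]
    by (simp add: fundamental_solution_iff mat_def)
  then show ?thesis by (simp add: det_2 algebra_simps)
qed

text \<open>
  The Wronskians of a column of \<open>\<Phi>\<close> with a column of \<open>\<Phi>\<close> and with the corresponding column of \<open>\<Psi>\<close>
  are constant with equal initial values. Hence the columns of \<open>\<Psi> 1 - \<Phi> 1\<close> have vanishing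
  Wronskian with both columns of the invertible matrix \<open>\<Phi> 1\<close>, so they are zero.
\<close>
lemma fundamental_solution_unique:
  assumes \<Phi>: "fundamental_solution a \<Phi>" and \<Psi>: "fundamental_solution a \<Psi>"
  shows "\<Psi> 1 = \<Phi> 1"
proof -
  define d where "d i j = \<Psi> 1 $ i $ j - \<Phi> 1 $ i $ j" for i j
  have W: "\<Phi> 1 $ 1 $ i * \<Psi> 1 $ 2 $ j - \<Phi> 1 $ 2 $ i * \<Psi> 1 $ 1 $ j
      = \<Phi> 1 $ 1 $ i * \<Phi> 1 $ 2 $ j - \<Phi> 1 $ 2 $ i * \<Phi> 1 $ 1 $ j" for i j
    using \<Phi> \<Psi>
      wronskian_constant[of a "\<lambda>t. \<Phi> t $ 1 $ i" "\<lambda>t. \<Phi> t $ 2 $ i" "\<lambda>t. \<Psi> t $ 1 $ j" "\<lambda>t. \<Psi> t $ 2 $ j"]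
      wronskian_constant[of a "\<lambda>t. \<Phi> t $ 1 $ i" "\<lambda>t. \<Phi> t $ 2 $ i" "\<lambda>t. \<Phi> t $ 1 $ j" "\<lambda>t. \<Phi> t $ 2 $ j"]
    by (simp add: fundamental_solution_iff)
  then have orth: "\<Phi> 1 $ 1 $ i * d 2 j = \<Phi> 1 $ 2 $ i * d 1 j" for i j
    by (simp add: d_def algebra_simps)
  have "d 1 j = 0 \<and> d 2 j = 0" for j
  proof -
    have "det (\<Phi> 1) * d 1 j = 0" "det (\<Phi> 1) * d 2 j = 0"
      using orth[of 1 j] orth[of 2 j] unfolding det_2 by algebra+
    then show ?thesis using fundamental_solution_det[OF \<Phi>] by simp
  qed
  then show ?thesis
    by (simp add: vec_eq_iff forall_2 d_def)
qed

lemma monodromy_eq: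
  assumes "fundamental_solution a \<Phi>"
  shows "monodromy a = \<Phi> 1"
  unfolding monodromy_def
  by (rule the_equality) (use assms fundamental_solution_unique in blast)+

lemma floquet_multipliers_iff:
  "\<mu> \<in> floquet_multipliers a \<longleftrightarrow>
     \<mu>\<^sup>2 - complex_of_real (trace (monodromy a)) * \<mu> + complex_of_real (det (monodromy a)) = 0"
proof -
  define m where "m i j = complex_of_real (monodromy a $ i $ j)" for i j
  have eigen: "complex_matrix (monodromy a) *v v = \<mu> *s v \<longleftrightarrow>
      m 1 1 * v $ 1 + m 1 2 * v $ 2 = \<mu> * v $ 1 \<and> m 2 1 * v $ 1 + m 2 2 * v $ 2 = \<mu> * v $ 2" for v
    by (simp add: vec_eq_iff forall_2 matrix_vector_mult_def sum_2 complex_matrix_def m_def)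
  have "\<mu>\<^sup>2 - complex_of_real (trace (monodromy a)) * \<mu> + complex_of_real (det (monodromy a))
      = (m 1 1 - \<mu>) * (m 2 2 - \<mu>) - m 1 2 * m 2 1"
    by (simp add: trace_def sum_2 det_2 m_def power2_eq_square algebra_simps)
  moreover have "\<mu> \<in> floquet_multipliers a \<longleftrightarrow> (m 1 1 - \<mu>) * (m 2 2 - \<mu>) - m 1 2 * m 2 1 = 0"
  proof
    assume "\<mu> \<in> floquet_multipliers a"
    then obtain v where v: "v \<noteq> 0" "complex_matrix (monodromy a) *v v = \<mu> *s v"
      unfolding floquet_multipliers_def by blast
    note row = conjunct1[OF eigen[THEN iffD1, OF v(2)]] conjunct2[OF eigen[THEN iffD1, OF v(2)]]
    have "((m 1 1 - \<mu>) * (m 2 2 - \<mu>) - m 1 2 * m 2 1) * v $ 1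
        = (m 2 2 - \<mu>) * (m 1 1 * v $ 1 + m 1 2 * v $ 2 - \<mu> * v $ 1)
          - m 1 2 * (m 2 1 * v $ 1 + m 2 2 * v $ 2 - \<mu> * v $ 2)"
      by (simp add: algebra_simps)
    then have "((m 1 1 - \<mu>) * (m 2 2 - \<mu>) - m 1 2 * m 2 1) * v $ 1 = 0"
      by (simp add: row)
    moreover have "((m 1 1 - \<mu>) * (m 2 2 - \<mu>) - m 1 2 * m 2 1) * v $ 2
        = (m 1 1 - \<mu>) * (m 2 1 * v $ 1 + m 2 2 * v $ 2 - \<mu> * v $ 2)
          - m 2 1 * (m 1 1 * v $ 1 + m 1 2 * v $ 2 - \<mu> * v $ 1)"
      by (simp add: algebra_simps)
    then have "((m 1 1 - \<mu>) * (m 2 2 - \<mu>) - m 1 2 * m 2 1) * v $ 2 = 0"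
      by (simp add: row)
    moreover have "v $ 1 \<noteq> 0 \<or> v $ 2 \<noteq> 0"
      using v(1) by (auto simp: vec_eq_iff forall_2)
    ultimately show "(m 1 1 - \<mu>) * (m 2 2 - \<mu>) - m 1 2 * m 2 1 = 0" by auto
  next
    assume D: "(m 1 1 - \<mu>) * (m 2 2 - \<mu>) - m 1 2 * m 2 1 = 0"
    have mem: "\<mu> \<in> floquet_multipliers a"
      if "p \<noteq> 0 \<or> q \<noteq> 0" "m 1 1 * p + m 1 2 * q = \<mu> * p" "m 2 1 * p + m 2 2 * q = \<mu> * q" for p q
    proof -
      have "vector [p, q] \<noteq> (0 :: complex^2)"
        using that(1) by (auto simp: vec_eq_iff forall_2)
      moreover have "complex_matrix (monodromy a) *v vector [p, q] = \<mu> *s vector [p, q]"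
        using that by (simp add: eigen)
      ultimately show ?thesis unfolding floquet_multipliers_def by blast
    qed
    \<comment> \<open>In the first two cases the eigenvector is taken orthogonal to a nonzero row of \<open>M - \<mu> I\<close>.\<close>
    consider "m 1 2 \<noteq> 0" | "m 2 1 \<noteq> 0" | "m 1 2 = 0" "m 2 1 = 0" "m 1 1 = \<mu>"
      | "m 1 2 = 0" "m 2 1 = 0" "m 2 2 = \<mu>"
      using D by (cases "m 1 2 = 0"; cases "m 2 1 = 0") auto
    then show "\<mu> \<in> floquet_multipliers a"
    proof cases
      case 1
      show ?thesis
        by (rule mem[of "m 1 2" "\<mu> - m 1 1"]) (use 1 D in \<open>simp_all add: algebra_simps\<close>)
    next
      case 2
      show ?thesis
        by (rule mem[of "\<mu> - m 2 2" "m 2 1"]) (use 2 D in \<open>simp_all add: algebra_simps\<close>)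
    next
      case 3
      then show ?thesis by (intro mem[of 1 0]) auto
    next
      case 4
      then show ?thesis by (intro mem[of 0 1]) auto
    qed
  qed
  ultimately show ?thesis by simp
qed

text \<open>
  The multipliers are the roots of \<open>\<mu>\<^sup>2 - T \<mu> + 1\<close> with negative discriminant: a conjugate pair
  with product 1.
\<close>
lemma strongly_stable_if_trace:
  assumes "det (monodromy a) = 1" "\<bar>trace (monodromy a)\<bar> < 2"
  shows "strongly_stable a"
  unfolding strongly_stable_def
proof
  fix \<mu> assume "\<mu> \<in> floquet_multipliers a"
  define T where "T = trace (monodromy a)"
  have root: "\<mu>\<^sup>2 - complex_of_real T * \<mu> + 1 = 0"
    using \<open>\<mu> \<in> floquet_multipliers a\<close> assms(1) by (simp add: floquet_multipliers_iff T_def)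
  have re: "(Re \<mu>)\<^sup>2 - (Im \<mu>)\<^sup>2 - T * Re \<mu> + 1 = 0" and im: "(2 * Re \<mu> - T) * Im \<mu> = 0"
    using arg_cong[OF root, of Re] arg_cong[OF root, of Im]
    by (simp_all add: power2_eq_square algebra_simps)
  have "T\<^sup>2 < 2\<^sup>2"
    using power_strict_mono[of "\<bar>T\<bar>" 2 2] assms(2) by (simp add: T_def)
  have "Im \<mu> \<noteq> 0"
  proof
    assume "Im \<mu> = 0"
    with re have "(Re \<mu> - T / 2)\<^sup>2 = T\<^sup>2 / 4 - 1"
      by (simp add: power2_eq_square field_simps)
    moreover have "(Re \<mu> - T / 2)\<^sup>2 \<ge> 0" by simp
    ultimately show False using \<open>T\<^sup>2 < 2\<^sup>2\<close> by simp
  qed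
  with im have "T = 2 * Re \<mu>" by simp
  with re have "(Re \<mu>)\<^sup>2 + (Im \<mu>)\<^sup>2 = 1" by (simp add: power2_eq_square)
  then show "cmod \<mu> = 1 \<and> \<mu> \<notin> \<real>"
    using \<open>Im \<mu> \<noteq> 0\<close> by (auto simp: cmod_def complex_is_Real_iff)
qed

text \<open>
  Here the characteristic polynomial is \<open>(\<mu> - \<epsilon>)\<^sup>2\<close> with \<open>\<epsilon> = \<plusminus>1\<close>.
\<close>
lemma parabolic_if_trace:
  assumes "det (monodromy a) = 1" "\<bar>trace (monodromy a)\<bar> = 2"
  shows "parabolic a" "\<not> strongly_stable a"
proof -
  obtain \<epsilon> :: real where \<epsilon>: "\<epsilon> = 1 \<or> \<epsilon> = -1" "trace (monodromy a) = 2 * \<epsilon>"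
    using assms(2) by (cases "trace (monodromy a) \<ge> 0") auto
  have "\<mu> \<in> floquet_multipliers a \<longleftrightarrow> (\<mu> - complex_of_real \<epsilon>)\<^sup>2 = 0" for \<mu>
    using \<epsilon> assms(1) by (auto simp: floquet_multipliers_iff power2_eq_square algebra_simps)
  then have *: "floquet_multipliers a = {complex_of_real \<epsilon>}" by auto
  show "parabolic a" using * \<epsilon>(1) by (auto simp: parabolic_def)
  show "\<not> strongly_stable a" using * by (auto simp: strongly_stable_def)
qed

section \<open>Polar coordinates in the phase plane\<close>

text \<open>
  The equation of the polar angle in the phase plane: if \<open>S = r sin \<theta>\<close> and \<open>S' = r cos \<theta>\<close>, then
  \<open>S'' + a S = 0\<close> decouples into this equation for \<open>\<theta>\<close> and a linear one for \<open>r\<close>.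
\<close>
definition prufer_solution :: "(real \<Rightarrow> real) \<Rightarrow> (real \<Rightarrow> real) \<Rightarrow> bool" where
  "prufer_solution a \<theta> \<longleftrightarrow>
     (\<forall>t\<in>{0..1}. (\<theta> has_real_derivative (cos (\<theta> t))\<^sup>2 + a t * (sin (\<theta> t))\<^sup>2) (at t within {0..1}))"

text \<open>
  The solution of \<open>r' = (1 - a) r sin \<theta> cos \<theta>\<close> with \<open>r 0 = 1\<close>.
\<close>
definition prufer_radius :: "(real \<Rightarrow> real) \<Rightarrow> (real \<Rightarrow> real) \<Rightarrow> real \<Rightarrow> real" where
  "prufer_radius a \<theta> t = exp (integral {0..t} (\<lambda>s. (1 - a s) * sin (\<theta> s) * cos (\<theta> s)))"

lemma prufer_solution_continuous: "prufer_solution a \<theta> \<Longrightarrow> continuous_on {0..1} \<theta>"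
  unfolding prufer_solution_def by (rule DERIV_continuous_on) blast

text \<open>
  Polar coordinates can be used in reverse: a solution of the scalar angle equation yields a
  solution of the linear system, so scalar existence theory suffices for both.
\<close>
lemma prufer_hill_solution:
  assumes a: "continuous_on {0..1} a" and \<theta>: "prufer_solution a \<theta>"
  shows "hill_solution a (\<lambda>t. prufer_radius a \<theta> t * sin (\<theta> t)) (\<lambda>t. prufer_radius a \<theta> t * cos (\<theta> t))"
  unfolding hill_solution_def
proof
  fix t :: real assume t: "t \<in> {0..1}"
  note d\<theta> = \<theta>[unfolded prufer_solution_def, rule_format, OF t]
  have "continuous_on {0..1} (\<lambda>s. (1 - a s) * sin (\<theta> s) * cos (\<theta> s))"
    using a prufer_solution_continuous[OF \<theta>] by (intro continuous_intros)
  from integral_has_real_derivative[OF this t]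
  have dr: "(prufer_radius a \<theta> has_real_derivative
      prufer_radius a \<theta> t * ((1 - a t) * sin (\<theta> t) * cos (\<theta> t))) (at t within {0..1})"
    unfolding prufer_radius_def by (auto intro!: derivative_eq_intros)
  \<comment> \<open>The exponent in the radius is chosen so that these combinations reduce to
      \<open>cos\<^sup>2 + sin\<^sup>2 = 1\<close>.\<close>
  have alg: "(1 - A) * s * c * s + c * (c\<^sup>2 + A * s\<^sup>2) = c * (s\<^sup>2 + c\<^sup>2)"
      "(1 - A) * s * c * c - s * (c\<^sup>2 + A * s\<^sup>2) = - A * s * (s\<^sup>2 + c\<^sup>2)" for A s c :: real
    by (simp_all add: algebra_simps power2_eq_square)
  have s: "(1 - a t) * sin (\<theta> t) * cos (\<theta> t) * sin (\<theta> t)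
        + cos (\<theta> t) * ((cos (\<theta> t))\<^sup>2 + a t * (sin (\<theta> t))\<^sup>2) = cos (\<theta> t)"
    using alg(1)[of "a t" "sin (\<theta> t)" "cos (\<theta> t)"] by (simp only: sin_cos_squared_add mult_1_right)
  have c: "(1 - a t) * sin (\<theta> t) * cos (\<theta> t) * cos (\<theta> t)
        - sin (\<theta> t) * ((cos (\<theta> t))\<^sup>2 + a t * (sin (\<theta> t))\<^sup>2) = - a t * sin (\<theta> t)"
    using alg(2)[of "a t" "sin (\<theta> t)" "cos (\<theta> t)"] by (simp only: sin_cos_squared_add mult_1_right)
  have "((\<lambda>t. prufer_radius a \<theta> t * sin (\<theta> t)) has_real_derivative
      prufer_radius a \<theta> t * ((1 - a t) * sin (\<theta> t) * cos (\<theta> t) * sin (\<theta> t)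
        + cos (\<theta> t) * ((cos (\<theta> t))\<^sup>2 + a t * (sin (\<theta> t))\<^sup>2))) (at t within {0..1})"
    by (rule DERIV_cong[OF DERIV_mult[OF dr DERIV_chain2[OF DERIV_sin d\<theta>]]]) (simp only: algebra_simps)
  moreover have "((\<lambda>t. prufer_radius a \<theta> t * cos (\<theta> t)) has_real_derivative
      prufer_radius a \<theta> t * ((1 - a t) * sin (\<theta> t) * cos (\<theta> t) * cos (\<theta> t)
        - sin (\<theta> t) * ((cos (\<theta> t))\<^sup>2 + a t * (sin (\<theta> t))\<^sup>2))) (at t within {0..1})"
    by (rule DERIV_cong[OF DERIV_mult[OF dr DERIV_chain2[OF DERIV_cos d\<theta>]]])
       (simp add: algebra_simps)
  ultimately show "((\<lambda>t. prufer_radius a \<theta> t * sin (\<theta> t)) has_real_derivative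
        prufer_radius a \<theta> t * cos (\<theta> t)) (at t within {0..1}) \<and>
      ((\<lambda>t. prufer_radius a \<theta> t * cos (\<theta> t)) has_real_derivative
        - a t * (prufer_radius a \<theta> t * sin (\<theta> t))) (at t within {0..1})"
    unfolding s c by (simp add: mult_ac)
qed

text \<open>
  The initial angles \<open>\<pi> / 2\<close> and \<open>0\<close> are those of the unit vectors \<open>(1, 0)\<close> and \<open>(0, 1)\<close>.
\<close>
lemma monodromy_prufer:
  assumes a: "continuous_on {0..1} a"
    and \<alpha>: "prufer_solution a \<alpha>" "\<alpha> 0 = pi / 2"
    and \<beta>: "prufer_solution a \<beta>" "\<beta> 0 = 0"
  shows "monodromy a = vector
           [vector [prufer_radius a \<alpha> 1 * sin (\<alpha> 1), prufer_radius a \<beta> 1 * sin (\<beta> 1)],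
            vector [prufer_radius a \<alpha> 1 * cos (\<alpha> 1), prufer_radius a \<beta> 1 * cos (\<beta> 1)]]"
    and "det (monodromy a) = 1"
proof -
  define \<Phi> :: "real \<Rightarrow> real^2^2" where "\<Phi> t = vector
    [vector [prufer_radius a \<alpha> t * sin (\<alpha> t), prufer_radius a \<beta> t * sin (\<beta> t)],
     vector [prufer_radius a \<alpha> t * cos (\<alpha> t), prufer_radius a \<beta> t * cos (\<beta> t)]]" for t
  have "\<Phi> 0 = mat 1"
    by (simp add: \<alpha>(2) \<beta>(2) \<Phi>_def mat_def vec_eq_iff forall_2 prufer_radius_def)
  moreover have "\<forall>j. hill_solution a (\<lambda>t. \<Phi> t $ 1 $ j) (\<lambda>t. \<Phi> t $ 2 $ j)"
    using prufer_hill_solution[OF a \<alpha>(1)] prufer_hill_solution[OF a \<beta>(1)]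
    by (simp add: forall_2 \<Phi>_def)
  ultimately have "fundamental_solution a \<Phi>"
    by (simp add: fundamental_solution_iff)
  from monodromy_eq[OF this] fundamental_solution_det[OF this]
  show "monodromy a = vector
           [vector [prufer_radius a \<alpha> 1 * sin (\<alpha> 1), prufer_radius a \<beta> 1 * sin (\<beta> 1)],
            vector [prufer_radius a \<alpha> 1 * cos (\<alpha> 1), prufer_radius a \<beta> 1 * cos (\<beta> 1)]]"
    and "det (monodromy a) = 1"
    by (simp_all add: \<Phi>_def)
qed

section \<open>Half turns and the trace\<close>

lemma sum_with_reciprocal_ge_2:
  fixes x y :: real
  assumes "x * y = 1" "y > 0"
  shows "x + y \<ge> 2"
proof -
  have "(x + y - 2) * y = (y - 1)\<^sup>2"
    using assms(1) by (simp add: algebra_simps power2_eq_square)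
  then have "(x + y - 2) * y \<ge> 0" by simp
  with \<open>y > 0\<close> show ?thesis by (simp add: zero_le_mult_iff)
qed

text \<open>
  After \<open>k\<close> half turns the vector \<open>(0, 1)\<close> is mapped to a multiple of itself, the factor having
  the sign of \<open>(-1)^k\<close>. By the determinant the other multiplier is its reciprocal, and the sum of
  a nonzero real number and its reciprocal is at least 2 in modulus.
\<close>
lemma trace_monodromy_half_turns:
  fixes k :: int
  assumes a: "continuous_on {0..1} a"
    and \<alpha>: "prufer_solution a \<alpha>" "\<alpha> 0 = pi / 2"
    and \<beta>: "prufer_solution a \<beta>" "\<beta> 0 = 0"
    and k: "\<beta> 1 = of_int k * pi"
  shows "if even k then trace (monodromy a) \<ge> 2 else trace (monodromy a) \<le> -2"
proof -
  define x y where "x = prufer_radius a \<alpha> 1 * sin (\<alpha> 1)" and "y = prufer_radius a \<beta> 1 * cos (\<beta> 1)"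
  have sin0: "sin (\<beta> 1) = 0" and cos1: "cos (\<beta> 1) = (if even k then 1 else -1)"
    using k by (simp_all add: sin_npi_int cos_npi_int mult.commute)
  have xy: "x * y = 1"
    using monodromy_prufer[OF a \<alpha> \<beta>] sin0 by (simp add: det_2 x_def y_def)
  have tr: "trace (monodromy a) = x + y"
    using monodromy_prufer(1)[OF a \<alpha> \<beta>] by (simp add: trace_def sum_2 x_def y_def)
  show ?thesis
  proof (cases "even k")
    case True
    then have "y > 0" using cos1 by (simp add: y_def prufer_radius_def)
    with sum_with_reciprocal_ge_2[OF xy] True tr show ?thesis by simp
  next
    case False
    then have "-y > 0" using cos1 by (simp add: y_def prufer_radius_def)
    with sum_with_reciprocal_ge_2[of "-x" "-y"] xy False tr show ?thesis by simp
  qed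
qed

section \<open>Bounds for the rotation\<close>

lemma increment_ge_of_derivative_ge:
  fixes f f' :: "real \<Rightarrow> real"
  assumes d: "\<And>t. t \<in> {0..1} \<Longrightarrow> (f has_real_derivative f' t) (at t within {0..1})"
    and "0 \<le> s" "s \<le> t" "t \<le> 1" "\<And>u. u \<in> {s..t} \<Longrightarrow> f' u \<ge> c"
  shows "f t - f s \<ge> c * (t - s)"
proof -
  have "(\<lambda>u. f u - c * u) s \<le> (\<lambda>u. f u - c * u) t"
  proof (rule DERIV_nonneg_imp_increasing_open[OF \<open>s \<le> t\<close>])
    fix u assume u: "s < u" "u < t"
    then have "at u within {0..1} = at u"
      using assms(2-4) by (intro at_within_Icc_at) auto
    with d[of u] u assms(2-4) have "(f has_real_derivative f' u) (at u)" by simp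
    then have "((\<lambda>u. f u - c * u) has_real_derivative f' u - c) (at u)"
      by (auto intro!: derivative_eq_intros)
    moreover have "f' u - c \<ge> 0" using assms(5)[of u] u by simp
    ultimately show "\<exists>y. DERIV (\<lambda>u. f u - c * u) u :> y \<and> y \<ge> 0" by blast
  next
    have "continuous_on {0..1} f" using d by (rule DERIV_continuous_on)
    then have "continuous_on {s..t} f" by (rule continuous_on_subset) (use assms(2-4) in auto)
    then show "continuous_on {s..t} (\<lambda>u. f u - c * u)" by (intro continuous_intros)
  qed
  then show ?thesis by (simp add: algebra_simps)
qed

lemma prufer_angle_le:
  assumes \<theta>: "prufer_solution a \<theta>" and a: "\<And>t. t \<in> {0..1} \<Longrightarrow> a t \<le> K" and "K \<ge> 0"
  shows "\<theta> 1 \<le> \<theta> 0 + 1 + K"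
proof -
  have "(\<lambda>t. - \<theta> t) 1 - (\<lambda>t. - \<theta> t) 0 \<ge> - (1 + K) * (1 - 0)"
  proof (rule increment_ge_of_derivative_ge)
    fix t :: real assume t: "t \<in> {0..1}"
    then show "((\<lambda>t. - \<theta> t) has_real_derivative - ((cos (\<theta> t))\<^sup>2 + a t * (sin (\<theta> t))\<^sup>2)) (at t within {0..1})"
      by (intro DERIV_minus) (use \<theta> in \<open>simp add: prufer_solution_def\<close>)
    have "a t * (sin (\<theta> t))\<^sup>2 \<le> K * (sin (\<theta> t))\<^sup>2"
      using a[OF t] by (intro mult_right_mono) auto
    also have "\<dots> \<le> K * 1"
      using \<open>K \<ge> 0\<close> by (intro mult_left_mono) (auto simp: abs_square_le_1)
    finally show "- (1 + K) \<le> - ((cos (\<theta> t))\<^sup>2 + a t * (sin (\<theta> t))\<^sup>2)"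
      using abs_square_le_1[of "cos (\<theta> t)"] abs_cos_le_one[of "\<theta> t"] by linarith
  qed auto
  then show ?thesis by simp
qed

text \<open>
  At a multiple of \<open>\<pi>\<close> the angle increases with speed 1 whatever the sign of the coefficient,
  so a solution never turns back across the axis \<open>S = 0\<close>.
\<close>
lemma prufer_angle_stays_above:
  fixes k :: int
  assumes \<theta>: "prufer_solution a \<theta>" and st: "0 \<le> s" "s \<le> t" "t \<le> 1" and s: "\<theta> s \<ge> of_int k * pi"
  shows "\<theta> t \<ge> of_int k * pi"
proof (rule ccontr)
  define y where "y = of_int k * pi"
  assume "\<not> \<theta> t \<ge> of_int k * pi"
  then have t: "\<theta> t < y" by (simp add: y_def)
  have cont: "continuous_on {p..q} \<theta>" if "s \<le> p" "q \<le> t" for p q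
    by (rule continuous_on_subset[OF prufer_solution_continuous[OF \<theta>]]) (use that st in auto)
  \<comment> \<open>At the last time \<open>m\<close> at which the angle equals \<open>y\<close> its derivative is 1, so the angle exceeds
      \<open>y\<close> just after \<open>m\<close> and must take the value \<open>y\<close> again before it gets below.\<close>
  define Z where "Z = {u \<in> {s..t}. \<theta> u = y}"
  have "closed Z"
    unfolding Z_def using continuous_closed_preimage_constant[OF cont[of s t], of y] by simp
  then have "compact Z"
    by (intro compact_eq_bounded_closed[THEN iffD2] conjI bounded_subset[of "{s..t}" Z]) (auto simp: Z_def)
  have "Z \<noteq> {}"
    using IVT2'[of \<theta> t y s, OF _ _ st(2) cont] s t by (auto simp: Z_def y_def)
  from compact_attains_sup[OF \<open>compact Z\<close> this]
  obtain m where m: "m \<in> Z" "\<And>u. u \<in> Z \<Longrightarrow> u \<le> m" by auto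
  have my: "\<theta> m = y" "s \<le> m" "m < t" using m(1) t by (auto simp: Z_def order.order_iff_strict)
  have "sin (\<theta> m) = 0" "(cos (\<theta> m))\<^sup>2 = 1"
    unfolding my(1) y_def by (simp_all add: mult.commute[of _ pi] sin_npi_int cos_npi_int)
  then have "(\<theta> has_real_derivative 1) (at m within {0..1})"
    using \<theta>[unfolded prufer_solution_def, rule_format, of m] my st by simp
  from has_real_derivative_pos_inc_right[OF this]
  obtain d where d: "d > 0" "\<And>h. h > 0 \<Longrightarrow> m + h \<in> {0..1} \<Longrightarrow> h < d \<Longrightarrow> \<theta> m < \<theta> (m + h)"
    by auto
  define h where "h = min (d / 2) ((t - m) / 2)"
  have h: "0 < h" "h < d" "m + h < t" "m + h \<in> {0..1}"
    using d(1) my st by (auto simp: h_def min_def field_simps)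
  have "\<theta> (m + h) > y" using d(2)[of h] h my by simp
  then obtain u where "u \<ge> m + h" "u \<le> t" "\<theta> u = y"
    using IVT2'[of \<theta> t y "m + h"] cont[of "m + h" t] h my t by auto
  then have "u \<in> Z" using h my by (auto simp: Z_def)
  from m(2)[OF this] \<open>u \<ge> m + h\<close> h(1) show False by simp
qed

text \<open>
  A smooth function that agrees with \<open>arctan (N tan u)\<close> modulo \<open>\<pi>\<close>: it is the angle seen after
  the phase plane is stretched so that solutions of \<open>S'' + N\<^sup>2 S = 0\<close> move on circles. Adding the
  difference of the two angles, which stays within \<open>\<pi> / 2\<close>, avoids the branches of \<open>arctan\<close>.
\<close>
definition stretched_angle :: "real \<Rightarrow> real \<Rightarrow> real" where
  "stretched_angle N u = u + arctan ((N - 1) * sin u * cos u / ((cos u)\<^sup>2 + N * (sin u)\<^sup>2))"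

lemma weighted_circle_pos:
  fixes N u :: real
  assumes "N > 0"
  shows "(cos u)\<^sup>2 + N * (sin u)\<^sup>2 > 0"
proof (cases "sin u = 0")
  case True
  then show ?thesis using sin_cos_squared_add[of u] by simp
next
  case False
  then show ?thesis using assms by (intro add_nonneg_pos) auto
qed

text \<open>
  With \<open>p / q\<close> the argument of \<open>arctan\<close>, the polynomial \<open>p\<^sup>2 + q\<^sup>2\<close> is the product of
  \<open>cos\<^sup>2 + N\<^sup>2 sin\<^sup>2\<close> and \<open>cos\<^sup>2 + sin\<^sup>2\<close>, and the numerator \<open>p' q - p q' + p\<^sup>2 + q\<^sup>2\<close> is \<open>N\<close>
  times a power of \<open>cos\<^sup>2 + sin\<^sup>2\<close>.
\<close>
lemma stretched_angle_derivative:
  assumes "N > 0"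
  shows "(stretched_angle N has_real_derivative N / ((cos u)\<^sup>2 + N\<^sup>2 * (sin u)\<^sup>2)) (at u within S)"
proof -
  define s c where "s = sin u" and "c = cos u"
  define q where "q = c\<^sup>2 + N * s\<^sup>2"
  define p where "p = (N - 1) * s * c"
  have sc: "s\<^sup>2 + c\<^sup>2 = 1" by (simp add: s_def c_def)
  have q: "q > 0" using weighted_circle_pos[OF assms, of u] by (simp add: q_def s_def c_def)
  have e: "c\<^sup>2 + N\<^sup>2 * s\<^sup>2 > 0"
    using weighted_circle_pos[of "N\<^sup>2" u] assms by (simp add: s_def c_def)
  have pq: "p\<^sup>2 + q\<^sup>2 = c\<^sup>2 + N\<^sup>2 * s\<^sup>2"
  proof -
    have "p\<^sup>2 + q\<^sup>2 = (c\<^sup>2 + N\<^sup>2 * s\<^sup>2) * (s\<^sup>2 + c\<^sup>2)"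
      by (simp add: p_def q_def power2_eq_square algebra_simps)
    then show ?thesis by (simp add: sc)
  qed
  have num: "(N - 1) * (c\<^sup>2 - s\<^sup>2) * q - p * (2 * (N - 1) * s * c) + (c\<^sup>2 + N\<^sup>2 * s\<^sup>2) = N"
  proof -
    have "(N - 1) * (c\<^sup>2 - s\<^sup>2) * q - p * (2 * (N - 1) * s * c) + (c\<^sup>2 + N\<^sup>2 * s\<^sup>2) * (s\<^sup>2 + c\<^sup>2)
        = N * (s\<^sup>2 + c\<^sup>2)\<^sup>2"
      by (simp add: p_def q_def power2_eq_square algebra_simps)
    then show ?thesis by (simp add: sc)
  qed
  have dp: "((\<lambda>u. (N - 1) * sin u * cos u) has_real_derivative (N - 1) * (c\<^sup>2 - s\<^sup>2)) (at u within S)"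
    by (auto intro!: derivative_eq_intros simp: s_def c_def power2_eq_square algebra_simps)
  have dq: "((\<lambda>u. (cos u)\<^sup>2 + N * (sin u)\<^sup>2) has_real_derivative 2 * (N - 1) * s * c) (at u within S)"
    by (auto intro!: derivative_eq_intros simp: s_def c_def power2_eq_square algebra_simps)
  have "((\<lambda>u. (N - 1) * sin u * cos u / ((cos u)\<^sup>2 + N * (sin u)\<^sup>2)) has_real_derivative
      ((N - 1) * (c\<^sup>2 - s\<^sup>2) * q - p * (2 * (N - 1) * s * c)) / (q * q)) (at u within S)"
    using DERIV_divide[OF dp dq] q unfolding p_def q_def s_def c_def by simp
  from DERIV_add[OF DERIV_ident DERIV_chain2[OF DERIV_arctan this]]
  have "(stretched_angle N has_real_derivative
      1 + inverse (1 + (p / q)\<^sup>2) * (((N - 1) * (c\<^sup>2 - s\<^sup>2) * q - p * (2 * (N - 1) * s * c)) / (q * q)))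
      (at u within S)"
    unfolding stretched_angle_def p_def q_def s_def c_def .
  moreover have "1 + inverse (1 + (p / q)\<^sup>2) * (((N - 1) * (c\<^sup>2 - s\<^sup>2) * q - p * (2 * (N - 1) * s * c)) / (q * q))
      = N / (c\<^sup>2 + N\<^sup>2 * s\<^sup>2)"
  proof -
    have "1 + (p / q)\<^sup>2 = (c\<^sup>2 + N\<^sup>2 * s\<^sup>2) / (q * q)"
      unfolding pq[symmetric] using q by (simp add: field_simps power2_eq_square)
    moreover have "(N - 1) * (c\<^sup>2 - s\<^sup>2) * q - p * (2 * (N - 1) * s * c) = N - (c\<^sup>2 + N\<^sup>2 * s\<^sup>2)"
      using num by simp
    moreover have "1 + inverse (E / (q * q)) * ((N - E) / (q * q)) = N / E" if "E > 0" for E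
      using that q by (simp add: field_simps)
    ultimately show ?thesis using e by simp
  qed
  ultimately show ?thesis by (simp add: s_def c_def)
qed

text \<open>
  Where the coefficient is at least \<open>N\<^sup>2\<close>, the stretched angle moves with speed at least \<open>N\<close>. The
  loss of \<open>3 / 2 \<pi>\<close> consists of \<open>\<pi> / 2\<close> for returning to the true angle and \<open>\<pi>\<close> for what may
  be unwound after time \<open>\<delta>\<close>.
\<close>
lemma prufer_angle_ge:
  assumes \<theta>: "prufer_solution a \<theta>" "\<theta> 0 = 0"
    and \<delta>: "0 \<le> \<delta>" "\<delta> \<le> 1" and "N > 0" and a: "\<And>t. t \<in> {0..\<delta>} \<Longrightarrow> a t \<ge> N\<^sup>2"
  shows "\<theta> 1 \<ge> N * \<delta> - 3 / 2 * pi"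
proof -
  have "(\<lambda>t. stretched_angle N (\<theta> t)) \<delta> - (\<lambda>t. stretched_angle N (\<theta> t)) 0 \<ge> N * (\<delta> - 0)"
  proof (rule increment_ge_of_derivative_ge)
    fix t :: real assume t: "t \<in> {0..1}"
    show "((\<lambda>t. stretched_angle N (\<theta> t)) has_real_derivative
        N / ((cos (\<theta> t))\<^sup>2 + N\<^sup>2 * (sin (\<theta> t))\<^sup>2) * ((cos (\<theta> t))\<^sup>2 + a t * (sin (\<theta> t))\<^sup>2)) (at t within {0..1})"
      using DERIV_image_chain[OF stretched_angle_derivative[OF \<open>N > 0\<close>] \<theta>(1)[unfolded prufer_solution_def, rule_format, OF t]]
      by (simp add: o_def)
  next
    fix t assume t: "t \<in> {0..\<delta>}"
    have pos: "(cos (\<theta> t))\<^sup>2 + N\<^sup>2 * (sin (\<theta> t))\<^sup>2 > 0"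
      using weighted_circle_pos[of "N\<^sup>2"] \<open>N > 0\<close> by simp
    have "N\<^sup>2 * (sin (\<theta> t))\<^sup>2 \<le> a t * (sin (\<theta> t))\<^sup>2"
      using a[OF t] by (intro mult_right_mono) auto
    then have "N * ((cos (\<theta> t))\<^sup>2 + N\<^sup>2 * (sin (\<theta> t))\<^sup>2) \<le> N * ((cos (\<theta> t))\<^sup>2 + a t * (sin (\<theta> t))\<^sup>2)"
      using \<open>N > 0\<close> by (intro mult_left_mono) auto
    then show "N \<le> N / ((cos (\<theta> t))\<^sup>2 + N\<^sup>2 * (sin (\<theta> t))\<^sup>2) * ((cos (\<theta> t))\<^sup>2 + a t * (sin (\<theta> t))\<^sup>2)"
      using pos by (simp add: pos_le_divide_eq)
  qed (use \<delta> in auto)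
  then have "stretched_angle N (\<theta> \<delta>) \<ge> N * \<delta>"
    using \<theta>(2) by (simp add: stretched_angle_def)
  then have "\<theta> \<delta> \<ge> N * \<delta> - pi / 2"
    using arctan_ubound[of "(N - 1) * sin (\<theta> \<delta>) * cos (\<theta> \<delta>) / ((cos (\<theta> \<delta>))\<^sup>2 + N * (sin (\<theta> \<delta>))\<^sup>2)"]
    unfolding stretched_angle_def by linarith
  \<comment> \<open>After time \<open>\<delta>\<close> the angle can fall back at most to the preceding multiple of \<open>\<pi>\<close>.\<close>
  moreover define k where "k = \<lfloor>\<theta> \<delta> / pi\<rfloor>"
  have k: "of_int k \<le> \<theta> \<delta> / pi" "\<theta> \<delta> / pi < of_int k + 1"
    unfolding k_def by linarith+
  then have "of_int k * pi \<le> \<theta> \<delta>" "\<theta> \<delta> < of_int k * pi + pi"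
    by (simp_all add: pos_le_divide_eq pos_divide_less_eq algebra_simps)
  moreover from this(1) have "\<theta> 1 \<ge> of_int k * pi"
    using prufer_angle_stays_above[OF \<theta>(1), of \<delta> 1 k] \<delta> by simp
  ultimately show ?thesis by simp
qed

section \<open>Continuity of the rotation in the parameter\<close>

text \<open>
  The angle equation is Lipschitz in the angle because
  \<open>sin\<^sup>2 u - sin\<^sup>2 v = sin (u + v) sin (u - v)\<close>.
\<close>
lemma prufer_solution_exists_param:
  fixes a :: "real \<Rightarrow> 'p::t2_space \<Rightarrow> real"
  assumes a: "continuous_on ({0..1} \<times> P) (\<lambda>(t, p). a t p)" and "compact P"
  obtains \<theta> where "continuous_on ({0..1} \<times> P) (\<lambda>(t, p). \<theta> t p)"
    and "\<And>p. \<theta> 0 p = \<theta>0"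
    and "\<And>p. p \<in> P \<Longrightarrow> prufer_solution (\<lambda>t. a t p) (\<lambda>t. \<theta> t p)"
proof -
  have "compact ((\<lambda>(t, p). a t p) ` ({0..1} \<times> P))"
    by (intro compact_continuous_image[OF a] compact_Times \<open>compact P\<close>) simp
  from compact_imp_bounded[OF this]
  obtain A where "\<forall>x\<in>(\<lambda>(t, p). a t p) ` ({0..1} \<times> P). norm x \<le> A"
    unfolding bounded_iff by blast
  then have A: "\<bar>a t p\<bar> \<le> A" if "t \<in> {0..1}" "p \<in> P" for t p
    using that by force
  define f where "f t p u = (cos u)\<^sup>2 + a t p * (sin u)\<^sup>2" for t p u
  have cont: "continuous_on ({0..1} \<times> P \<times> UNIV) (\<lambda>(t, p, u). f t p u)"
  proof -
    have "continuous_on ({0..1} \<times> P \<times> (UNIV :: real set)) (\<lambda>z. a (fst z) (fst (snd z)))"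
      by (rule continuous_on_compose2[OF a, of _ "\<lambda>z. (fst z, fst (snd z))", simplified])
         (auto intro!: continuous_intros)
    then show ?thesis
      unfolding f_def split_beta by (intro continuous_intros)
  qed
  have lip: "norm (f t p u - f t p v) \<le> (1 + \<bar>A\<bar>) * norm (u - v)" if "t \<in> {0..1}" "p \<in> P" for t p u v
  proof -
    have "sin (u + v) * sin (u - v) = (sin u)\<^sup>2 * (cos v)\<^sup>2 - (cos u)\<^sup>2 * (sin v)\<^sup>2"
      by (simp add: sin_add sin_diff power2_eq_square algebra_simps)
    also have "\<dots> = (sin u)\<^sup>2 - (sin v)\<^sup>2"
      by (simp add: cos_squared_eq algebra_simps)
    finally have sin2: "sin (u + v) * sin (u - v) = (sin u)\<^sup>2 - (sin v)\<^sup>2" .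
    have "f t p u - f t p v = (a t p - 1) * (sin (u + v) * sin (u - v))"
      unfolding sin2 by (simp add: f_def cos_squared_eq algebra_simps)
    then have "\<bar>f t p u - f t p v\<bar> = \<bar>a t p - 1\<bar> * (\<bar>sin (u + v)\<bar> * \<bar>sin (u - v)\<bar>)"
      by (simp add: abs_mult)
    also have "\<dots> \<le> (1 + \<bar>A\<bar>) * (1 * \<bar>u - v\<bar>)"
      using A[OF that] by (intro mult_mono abs_sin_le_one abs_sin_x_le_abs_x) auto
    finally show ?thesis by simp
  qed
  have bound: "norm (f t p \<theta>0) \<le> 1 + \<bar>A\<bar>" if "t \<in> {0..1}" "p \<in> P" for t p
  proof -
    have "norm (f t p \<theta>0) \<le> (cos \<theta>0)\<^sup>2 + \<bar>a t p\<bar> * (sin \<theta>0)\<^sup>2"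
      unfolding f_def by (auto intro!: order_trans[OF abs_triangle_ineq] simp: abs_mult)
    also have "\<dots> \<le> 1 + \<bar>A\<bar> * 1"
      using A[OF that] by (intro add_mono mult_mono) (auto simp: abs_square_le_1)
    finally show ?thesis by simp
  qed
  from picard_lindelof_param[OF cont lip bound]
  obtain \<theta> where \<theta>: "continuous_on ({0..1} \<times> P) (\<lambda>(t, p). \<theta> t p)" "\<And>p. \<theta> 0 p = \<theta>0"
    "\<And>t p. t \<in> {0..1} \<Longrightarrow> p \<in> P \<Longrightarrow>
           ((\<lambda>t. \<theta> t p) has_vector_derivative f t p (\<theta> t p)) (at t within {0..1})"
    by auto
  show thesis
    by (rule that[OF \<theta>(1,2)])
       (use \<theta>(3) in \<open>simp add: prufer_solution_def f_def has_real_derivative_iff_has_vector_derivative\<close>)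
qed

lemma continuous_on_prufer_radius:
  fixes a :: "real \<Rightarrow> 'p::t2_space \<Rightarrow> real"
  assumes a: "continuous_on ({0..1} \<times> P) (\<lambda>(t, p). a t p)"
    and \<theta>: "continuous_on ({0..1} \<times> P) (\<lambda>(t, p). \<theta> t p)"
  shows "continuous_on P (\<lambda>p. prufer_radius (\<lambda>t. a t p) (\<lambda>t. \<theta> t p) 1)"
proof -
  have "continuous_on ({0..1} \<times> P) (\<lambda>(s, p). (1 - a s p) * sin (\<theta> s p) * cos (\<theta> s p))"
    using a \<theta> unfolding split_beta by (intro continuous_intros)
  note integral_cont = continuous_on_integral_upto_param[OF this]
  have "continuous_on P (\<lambda>p. integral {0..1} (\<lambda>s. (1 - a s p) * sin (\<theta> s p) * cos (\<theta> s p)))"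
    by (rule continuous_on_compose2[OF integral_cont, of P "\<lambda>p. (1, p)", simplified])
       (auto intro!: continuous_intros)
  then show ?thesis
    unfolding prufer_radius_def by (intro continuous_intros)
qed

section \<open>Windows of strong stability\<close>

lemma monotone_crossing:
  fixes T :: "real \<Rightarrow> real"
  assumes cont: "continuous_on {p..q} T" and "p \<le> q" "T p \<le> -b" "T q \<ge> b" "b > 0"
  obtains p' q' where "p \<le> p'" "p' < q'" "q' \<le> q" "T p' = -b"
    "\<And>l. l \<in> {p'<..<q'} \<Longrightarrow> \<bar>T l\<bar> < b"
proof -
  have cont': "continuous_on {u..v} T" if "p \<le> u" "v \<le> q" for u v
    by (rule continuous_on_subset[OF cont]) (use that in auto)
  have level: "compact {l \<in> {u..v}. T l = y}" if "p \<le> u" "v \<le> q" for u v y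
  proof -
    have "closed {l \<in> {u..v}. T l = y}"
      using continuous_closed_preimage_constant[OF cont'[OF that], of y] by simp
    moreover have "bounded {l \<in> {u..v}. T l = y}"
      by (rule bounded_subset[of "{u..v}"]) auto
    ultimately show ?thesis by (simp add: compact_eq_bounded_closed)
  qed
  \<comment> \<open>The window lies between the last point at height \<open>-b\<close> and the first later point at height \<open>b\<close>.\<close>
  have "{l \<in> {p..q}. T l = -b} \<noteq> {}"
    using IVT'[of T p "-b" q] assms cont by auto
  from compact_attains_sup[OF level this]
  obtain p' where p': "p \<le> p'" "p' \<le> q" "T p' = -b" and last: "\<And>l. p \<le> l \<Longrightarrow> l \<le> q \<Longrightarrow> T l = -b \<Longrightarrow> l \<le> p'"
    by auto
  have "{l \<in> {p'..q}. T l = b} \<noteq> {}"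
    using IVT'[of T p' b q] assms p' cont' by auto
  from compact_attains_inf[OF level this] p'(1)
  obtain q' where q': "p' \<le> q'" "q' \<le> q" "T q' = b" and first: "\<And>l. p' \<le> l \<Longrightarrow> l \<le> q \<Longrightarrow> T l = b \<Longrightarrow> q' \<le> l"
    by auto
  have "p' \<noteq> q'" using p'(3) q'(3) \<open>b > 0\<close> by auto
  with q'(1) have "p' < q'" by simp
  moreover have "\<bar>T l\<bar> < b" if l: "l \<in> {p'<..<q'}" for l
  proof -
    have "T l > -b"
    proof (rule ccontr)
      assume "\<not> T l > -b"
      then obtain m where "l \<le> m" "m \<le> q'" "T m = -b"
        using IVT'[of T l "-b" q'] cont'[of l q'] l p' q' \<open>b > 0\<close> by auto
      then show False using last[of m] l p' q' by auto
    qed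
    moreover have "T l < b"
    proof (rule ccontr)
      assume "\<not> T l < b"
      then obtain m where "p' \<le> m" "m \<le> l" "T m = b"
        using IVT'[of T p' b l] cont'[of p' l] l p' q' \<open>b > 0\<close> by auto
      then show False using first[of m] l p' q' by auto
    qed
    ultimately show ?thesis by auto
  qed
  ultimately show thesis using that p' q' by blast
qed

lemma crossing_window:
  fixes T :: "real \<Rightarrow> real"
  assumes cont: "continuous_on {c..d} T" and "p \<in> {c..d}" "q \<in> {c..d}" "T p \<le> -b" "T q \<ge> b" "b > 0"
  obtains p' q' where "c \<le> p'" "p' < q'" "q' \<le> d" "\<bar>T p'\<bar> = b"
    "\<And>l. l \<in> {p'<..<q'} \<Longrightarrow> \<bar>T l\<bar> < b"
proof (cases "p \<le> q")
  case True
  have "continuous_on {p..q} T" by (rule continuous_on_subset[OF cont]) (use assms in auto)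
  from monotone_crossing[OF this True assms(4-6)]
  obtain p' q' where "p \<le> p'" "p' < q'" "q' \<le> q" "T p' = -b" "\<And>l. l \<in> {p'<..<q'} \<Longrightarrow> \<bar>T l\<bar> < b"
    by metis
  then show thesis using assms by (intro that[of p' q']) auto
next
  case False
  have "continuous_on {q..p} (\<lambda>l. - T l)"
    by (intro continuous_intros continuous_on_subset[OF cont]) (use assms in auto)
  then obtain p' q' where "q \<le> p'" "p' < q'" "q' \<le> p" "- T p' = -b" "\<And>l. l \<in> {p'<..<q'} \<Longrightarrow> \<bar>- T l\<bar> < b"
    by (rule monotone_crossing[where b = b]) (use False assms in auto)
  then show thesis using assms by (intro that[of p' q']) auto
qed

text \<open>
  The trace is at least 2 after an even number of half turns and at most \<open>-2\<close> after an odd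
  number, so a parameter interval over which the total rotation varies by \<open>2 \<pi>\<close> contains a full
  crossing of the band \<open>(-2, 2)\<close>. The rotation at \<open>d\<close> is at most \<open>1 + K\<close> and the one at \<open>c\<close> at
  least \<open>N \<delta> - 3 / 2 \<pi>\<close>; this accounts for the bound on \<open>N \<delta>\<close>. All rotation estimates are in
  terms of \<open>a\<close>, so the angles need only be constructed over the interval \<open>[c, d]\<close> at hand.
\<close>
proposition stable_window:
  fixes a :: "real \<Rightarrow> real \<Rightarrow> real"
  assumes a: "continuous_on ({0..1} \<times> {c..d}) (\<lambda>(t, l). a t l)" and "c \<le> d"
    and upper: "\<And>t. t \<in> {0..1} \<Longrightarrow> a t d \<le> K" "K \<ge> 0"
    and lower: "0 \<le> \<delta>" "\<delta> \<le> 1" "N > 0" "\<And>t. t \<in> {0..\<delta>} \<Longrightarrow> a t c \<ge> N\<^sup>2"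
    and turns: "N * \<delta> \<ge> K + 1 + 7 / 2 * pi"
  obtains p q where "c \<le> p" "p < q" "q \<le> d"
    and "parabolic (\<lambda>t. a t p)" "\<not> strongly_stable (\<lambda>t. a t p)"
    and "\<And>l. l \<in> {p<..<q} \<Longrightarrow> strongly_stable (\<lambda>t. a t l)"
proof -
  have a_slice: "continuous_on {0..1} (\<lambda>t. a t l)" if "l \<in> {c..d}" for l
    by (rule continuous_on_compose2[OF a, of _ "\<lambda>t. (t, l)", simplified])
       (use that in \<open>auto intro!: continuous_intros\<close>)
  obtain \<alpha> where \<alpha>: "continuous_on ({0..1} \<times> {c..d}) (\<lambda>(t, l). \<alpha> t l)" "\<And>l. \<alpha> 0 l = pi / 2"
      "\<And>l. l \<in> {c..d} \<Longrightarrow> prufer_solution (\<lambda>t. a t l) (\<lambda>t. \<alpha> t l)"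
    using prufer_solution_exists_param[OF a compact_Icc, of "pi / 2"] by blast
  obtain \<beta> where \<beta>: "continuous_on ({0..1} \<times> {c..d}) (\<lambda>(t, l). \<beta> t l)" "\<And>l. \<beta> 0 l = 0"
      "\<And>l. l \<in> {c..d} \<Longrightarrow> prufer_solution (\<lambda>t. a t l) (\<lambda>t. \<beta> t l)"
    using prufer_solution_exists_param[OF a compact_Icc, of 0] by blast
  have at_1: "continuous_on {c..d} (\<lambda>l. \<theta> 1 l)"
    if "continuous_on ({0..1} \<times> {c..d}) (\<lambda>(t, l). \<theta> t l)" for \<theta> :: "real \<Rightarrow> real \<Rightarrow> real"
    by (rule continuous_on_compose2[OF that, of _ "\<lambda>l. (1, l)", simplified]) (auto intro!: continuous_intros)
  define T where "T l = trace (monodromy (\<lambda>t. a t l))" for l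
  have mono: "monodromy (\<lambda>t. a t l) = vector
           [vector [prufer_radius (\<lambda>t. a t l) (\<lambda>t. \<alpha> t l) 1 * sin (\<alpha> 1 l), prufer_radius (\<lambda>t. a t l) (\<lambda>t. \<beta> t l) 1 * sin (\<beta> 1 l)],
            vector [prufer_radius (\<lambda>t. a t l) (\<lambda>t. \<alpha> t l) 1 * cos (\<alpha> 1 l), prufer_radius (\<lambda>t. a t l) (\<lambda>t. \<beta> t l) 1 * cos (\<beta> 1 l)]]"
    and det1: "det (monodromy (\<lambda>t. a t l)) = 1" if "l \<in> {c..d}" for l
    using monodromy_prufer[OF a_slice[OF that] \<alpha>(3)[OF that] \<alpha>(2) \<beta>(3)[OF that] \<beta>(2)] by simp_all
  have "continuous_on {c..d} (\<lambda>l. prufer_radius (\<lambda>t. a t l) (\<lambda>t. \<alpha> t l) 1 * sin (\<alpha> 1 l)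
      + prufer_radius (\<lambda>t. a t l) (\<lambda>t. \<beta> t l) 1 * cos (\<beta> 1 l))"
    by (intro continuous_intros continuous_on_prufer_radius a \<alpha> \<beta> at_1)
  also have "?this \<longleftrightarrow> continuous_on {c..d} T"
    by (rule continuous_on_cong) (simp_all add: T_def mono trace_def sum_2)
  finally have T_cont: "continuous_on {c..d} T" .
  have half_turns: "if even k then T l \<ge> 2 else T l \<le> -2"
    if "l \<in> {c..d}" "\<beta> 1 l = of_int k * pi" for l k
    unfolding T_def
    by (rule trace_monodromy_half_turns[OF a_slice \<alpha>(3) \<alpha>(2) \<beta>(3) \<beta>(2)]) (use that in auto)
  \<comment> \<open>\<open>k \<pi>\<close> and \<open>(k + 1) \<pi>\<close> both lie between the angles at the parameters \<open>d\<close> and \<open>c\<close>. One of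
      them is an even multiple of \<open>\<pi>\<close> and one an odd multiple, which fixes the sign of the trace.\<close>
  define k where "k = \<lceil>\<beta> 1 d / pi\<rceil>"
  have k: "\<beta> 1 d / pi \<le> of_int k" "of_int k < \<beta> 1 d / pi + 1"
    unfolding k_def by linarith+
  have k_ge: "\<beta> 1 d \<le> of_int k * pi" and k_le: "of_int k * pi \<le> \<beta> 1 d + pi"
    using k by (simp_all add: pos_divide_le_eq pos_less_divide_eq field_simps)
  have "\<beta> 1 d \<le> 1 + K"
    using prufer_angle_le[OF \<beta>(3) upper] \<open>c \<le> d\<close> \<beta>(2) by simp
  moreover have "\<beta> 1 c \<ge> N * \<delta> - 3 / 2 * pi"
    using prufer_angle_ge[OF \<beta>(3) \<beta>(2) lower] \<open>c \<le> d\<close> by simp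
  ultimately have "\<beta> 1 d + 2 * pi \<le> \<beta> 1 c" using turns by simp
  then have k_c: "of_int k * pi \<le> \<beta> 1 c" "of_int (k + 1) * pi \<le> \<beta> 1 c" "\<beta> 1 d \<le> of_int (k + 1) * pi"
    using k_le k_ge pi_gt_zero by (simp_all add: algebra_simps)
  obtain l1 where l1: "l1 \<in> {c..d}" "\<beta> 1 l1 = of_int k * pi"
    using IVT2'[of "\<lambda>l. \<beta> 1 l" d "of_int k * pi" c] at_1[OF \<beta>(1)] k_ge k_c \<open>c \<le> d\<close> by auto
  obtain l2 where l2: "l2 \<in> {c..d}" "\<beta> 1 l2 = of_int (k + 1) * pi"
    using IVT2'[of "\<lambda>l. \<beta> 1 l" d "of_int (k + 1) * pi" c] at_1[OF \<beta>(1)] k_c \<open>c \<le> d\<close> by auto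
  obtain u v where uv: "u \<in> {c..d}" "v \<in> {c..d}" "T u \<le> -2" "T v \<ge> 2"
    using half_turns[OF l1] half_turns[OF l2] l1(1) l2(1) by (cases "even k") auto
  obtain p q where pq: "c \<le> p" "p < q" "q \<le> d" "\<bar>T p\<bar> = 2" "\<And>l. l \<in> {p<..<q} \<Longrightarrow> \<bar>T l\<bar> < 2"
    using crossing_window[OF T_cont uv] by auto
  show thesis
  proof (rule that[OF pq(1-3)])
    show "parabolic (\<lambda>t. a t p)" "\<not> strongly_stable (\<lambda>t. a t p)"
      using parabolic_if_trace[OF det1] pq by (auto simp: T_def)
    show "strongly_stable (\<lambda>t. a t l)" if "l \<in> {p<..<q}" for l
      using strongly_stable_if_trace[OF det1] pq(5)[OF that] pq(1-3) that by (auto simp: T_def)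
  qed
qed

text \<open>
  Windows are chosen one after the other, each to the left of the previous one and within
  distance \<open>l0 / n\<close> of zero.
\<close>
lemma alternating_sequence:
  fixes l0 :: real and Good :: "real \<Rightarrow> bool" and Bad :: "real \<Rightarrow> bool"
  assumes "l0 > 0"
    and window: "\<And>e. e > 0 \<Longrightarrow> e \<le> l0 \<Longrightarrow>
      \<exists>p q. 0 < p \<and> p < q \<and> q \<le> e \<and> Bad p \<and> (\<forall>l\<in>{p<..<q}. Good l)"
  shows "\<exists>L :: nat \<Rightarrow> real.
      (\<forall>n\<ge>1. L n \<in> {0<..l0}) \<and>
      (\<forall>n\<ge>1. L (2*n - 1) > L (2*n) \<and> L (2*n) \<ge> L (2*n + 1)) \<and>
      L \<longlonglongrightarrow> 0 \<and>
      (\<forall>n\<ge>1. \<forall>l\<in>{L (2*n)<..<L (2*n - 1)}. Good l) \<and>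
      (\<forall>n\<ge>1. Bad (L (2*n)))"
proof -
  define W where "W w \<longleftrightarrow> 0 < fst w \<and> fst w < snd w \<and> snd w \<le> l0 \<and> Bad (fst w) \<and>
    (\<forall>l\<in>{fst w<..<snd w}. Good l)" for w :: "real \<times> real"
  have step: "\<exists>w. W w \<and> snd w \<le> e" if "e > 0" "e \<le> l0" for e
    using window[OF that] that by (force simp: W_def)
  have "\<exists>w. \<forall>n. (W (w n) \<and> snd (w n) \<le> l0 / Suc n) \<and> snd (w (Suc n)) \<le> fst (w n)"
  proof (rule dependent_nat_choice)
    show "\<exists>w. W w \<and> snd w \<le> l0 / Suc 0" using step[of l0] \<open>l0 > 0\<close> by simp
  next
    fix w n assume w: "W w \<and> snd w \<le> l0 / real (Suc n)"
    define e where "e = min (fst w) (l0 / Suc (Suc n))"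
    have "e > 0" "e \<le> l0" using w \<open>l0 > 0\<close> by (auto simp: e_def W_def min_def)
    from step[OF this] show "\<exists>w'. (W w' \<and> snd w' \<le> l0 / real (Suc (Suc n))) \<and> snd w' \<le> fst w"
      by (auto simp: e_def)
  qed
  then obtain w where w: "\<And>n. W (w n)" "\<And>n. snd (w n) \<le> l0 / Suc n" "\<And>n. snd (w (Suc n)) \<le> fst (w n)"
    by blast
  \<comment> \<open>The window \<open>w n\<close> occupies the indices \<open>2 n + 1\<close> (right end) and \<open>2 n + 2\<close> (left end). The value
      at index 0 is a dummy.\<close>
  define L where "L m = (if even m then fst (w (m div 2 - 1)) else snd (w (m div 2)))" for m
  have even: "L (2 * n) = fst (w (n - 1))" for n by (simp add: L_def)
  have odd_m: "L (2 * n - 1) = snd (w (n - 1))" if n: "n \<ge> 1" for n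
  proof -
    obtain k where "n = Suc k" using n by (cases n) auto
    then show ?thesis by (simp add: L_def)
  qed
  have odd_p: "L (2 * n + 1) = snd (w n)" for n by (simp add: L_def)
  have bounds: "0 < L m" "L m \<le> 2 * l0 / m" "L m \<le> l0" if "m \<ge> 1" for m
  proof -
    have "\<exists>n. 0 < L m \<and> L m \<le> snd (w n) \<and> m \<le> 2 * Suc n"
    proof (cases "even m")
      case True
      then have "m = 2 * Suc (m div 2 - 1)" using that by auto
      then show ?thesis
        using w(1)[of "m div 2 - 1"] True by (intro exI[of _ "m div 2 - 1"]) (simp add: L_def W_def)
    next
      case False
      then show ?thesis
        using w(1)[of "m div 2"] by (intro exI[of _ "m div 2"]) (auto simp: L_def W_def)
    qed
    then obtain n where n: "0 < L m" "L m \<le> snd (w n)" "m \<le> 2 * Suc n" by blast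
    show "0 < L m" by fact
    have "real m \<le> 2 * real (Suc n)" using n(3) by linarith
    then have "l0 / Suc n \<le> 2 * l0 / m"
      using that \<open>l0 > 0\<close> by (simp add: field_simps del: of_nat_Suc)
    with n(2) w(2)[of n] show "L m \<le> 2 * l0 / m" by linarith
    show "L m \<le> l0" using n(2) w(1)[of n] by (simp add: W_def)
  qed
  have "L \<longlonglongrightarrow> 0"
    by (rule tendsto_sandwich[OF _ _ tendsto_const lim_const_over_n[of "2 * l0"]])
       (use bounds in \<open>auto intro!: eventually_sequentiallyI[of 1] intro: less_imp_le\<close>)
  moreover have "L (2*n - 1) > L (2*n) \<and> L (2*n) \<ge> L (2*n + 1)" if "n \<ge> 1" for n
    using w(1)[of "n - 1"] w(3)[of "n - 1"] that unfolding even odd_m[OF that] odd_p by (simp add: W_def)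
  moreover have "\<forall>l\<in>{L (2*n)<..<L (2*n - 1)}. Good l" if "n \<ge> 1" for n
    using w(1)[of "n - 1"] unfolding even odd_m[OF that] by (simp add: W_def)
  moreover have "Bad (L (2*n))" if "n \<ge> 1" for n
    using w(1)[of "n - 1"] unfolding even by (simp add: W_def)
  ultimately show ?thesis
    using bounds by (intro exI[of _ L]) auto
qed

section \<open>The linearized potential near collision\<close>

text \<open>
  At a critical point \<open>(f - w) \<bullet> f'\<close> vanishes, and with it the term in which the second
  differentiation falls on the power of the distance.
\<close>
lemma inverse_distance_derivatives:
  fixes f f' f'' :: "real \<Rightarrow> 'a::real_inner"
  assumes "open I" "s0 \<in> I"
    and f: "\<And>s. s \<in> I \<Longrightarrow> (f has_vector_derivative f' s) (at s)"
    and f': "\<And>s. s \<in> I \<Longrightarrow> (f' has_vector_derivative f'' s) (at s)"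
    and pos: "\<And>s. s \<in> I \<Longrightarrow> norm (f s - w) > 0"
    and crit: "deriv (\<lambda>s. - inverse (norm (f s - w))) s0 = 0"
  shows "(deriv ^^ 2) (\<lambda>s. - inverse (norm (f s - w))) s0
       = (f' s0 \<bullet> f' s0 + (f s0 - w) \<bullet> f'' s0) / norm (f s0 - w) ^ 3"
proof -
  define n h where "n s = norm (f s - w)" and "h s = (f s - w) \<bullet> f' s" for s
  have dz: "((\<lambda>s. f s - w) has_vector_derivative f' s) (at s)" if "s \<in> I" for s
    using has_vector_derivative_diff[OF f[OF that] has_vector_derivative_const[of w]] by simp
  have dn: "(n has_real_derivative h s / n s) (at s)" if "s \<in> I" for s
  proof -
    have "((\<lambda>s. (f s - w) \<bullet> (f s - w)) has_real_derivative 2 * h s) (at s)"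
      using bounded_bilinear.has_vector_derivative[OF bounded_bilinear_inner dz[OF that] dz[OF that]]
      by (simp add: has_real_derivative_iff_has_vector_derivative h_def inner_commute)
    moreover have "(f s - w) \<bullet> (f s - w) > 0" using pos[OF that] by simp
    ultimately have "((\<lambda>s. sqrt ((f s - w) \<bullet> (f s - w))) has_real_derivative
        (inverse (sqrt ((f s - w) \<bullet> (f s - w))) / 2) * (2 * h s)) (at s)"
      by (intro DERIV_chain2[OF DERIV_real_sqrt])
    then show ?thesis
      by (simp add: n_def[abs_def] norm_eq_sqrt_inner field_simps)
  qed
  have dh: "(h has_real_derivative f' s \<bullet> f' s + (f s - w) \<bullet> f'' s) (at s)" if "s \<in> I" for s
    using bounded_bilinear.has_vector_derivative[OF bounded_bilinear_inner dz[OF that] f'[OF that]]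
    by (simp add: has_real_derivative_iff_has_vector_derivative h_def[abs_def] add.commute)
  have n_pos: "n s > 0" if "s \<in> I" for s using pos[OF that] by (simp add: n_def)
  have first: "deriv (\<lambda>s. - inverse (norm (f s - w))) s = h s / n s ^ 3" if "s \<in> I" for s
  proof -
    have "((\<lambda>s. - inverse (n s)) has_real_derivative h s / n s ^ 3) (at s)"
      using n_pos[OF that]
      by (auto intro!: derivative_eq_intros dn that simp: power3_eq_cube field_simps)
    then show ?thesis unfolding n_def by (rule DERIV_imp_deriv)
  qed
  have h0: "h s0 = 0"
    using crit first[OF \<open>s0 \<in> I\<close>] n_pos[OF \<open>s0 \<in> I\<close>] by simp
  have "((\<lambda>s. h s / n s ^ 3) has_real_derivative
      (f' s0 \<bullet> f' s0 + (f s0 - w) \<bullet> f'' s0) / n s0 ^ 3) (at s0)"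
    using n_pos[OF \<open>s0 \<in> I\<close>]
    by (auto intro!: derivative_eq_intros dn dh \<open>s0 \<in> I\<close> simp: h0 power3_eq_cube field_simps)
  then have "(deriv (\<lambda>s. - inverse (norm (f s - w))) has_real_derivative
      (f' s0 \<bullet> f' s0 + (f s0 - w) \<bullet> f'' s0) / n s0 ^ 3) (at s0)"
    by (rule has_field_derivative_transform_within_open[OF _ \<open>open I\<close> \<open>s0 \<in> I\<close>]) (simp add: first)
  then show ?thesis
    by (simp add: numeral_2_eq_2 n_def DERIV_imp_deriv)
qed

lemma C2_bounded_on_mono: "C2_bounded_on I f B \<Longrightarrow> B \<le> B' \<Longrightarrow> C2_bounded_on I f B'"
proof -
  assume f: "C2_bounded_on I f B" and "B \<le> B'"
  from f obtain f' f'' where f': "\<forall>s\<in>I. (f has_vector_derivative f' s) (at s)"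
      "\<forall>s\<in>I. (f' has_vector_derivative f'' s) (at s)" "continuous_on I f''"
      "\<forall>s\<in>I. norm (f s) \<le> B \<and> norm (f' s) \<le> B \<and> norm (f'' s) \<le> B"
    unfolding C2_bounded_on_def by blast
  from f'(4) have "\<forall>s\<in>I. norm (f s) \<le> B' \<and> norm (f' s) \<le> B' \<and> norm (f'' s) \<le> B'"
    using \<open>B \<le> B'\<close> by (meson order_trans)
  with f'(1-3) show "C2_bounded_on I f B'"
    unfolding C2_bounded_on_def by blast
qed

lemma C2_bounded_on_Lipschitz:
  assumes "C2_bounded_on UNIV g B"
  shows "norm (g t - g s) \<le> B * \<bar>t - s\<bar>"
proof -
  obtain g' where g': "\<And>u. (g has_vector_derivative g' u) (at u)" "\<And>u. norm (g' u) \<le> B"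
    using assms unfolding C2_bounded_on_def by auto
  have "norm (g t - g s) \<le> B * norm (t - s)"
  proof (rule differentiable_bound[of UNIV g "\<lambda>u h. h *\<^sub>R g' u"])
    show "(g has_derivative (\<lambda>h. h *\<^sub>R g' u)) (at u within UNIV)" for u
      using g'(1)[of u] by (simp add: has_vector_derivative_def)
    show "onorm (\<lambda>h. h *\<^sub>R g' u) \<le> B" for u
    proof (rule onorm_bound)
      show "B \<ge> 0" using g'(2)[of u] norm_ge_zero[of "g' u"] by linarith
      show "norm (h *\<^sub>R g' u) \<le> B * norm h" for h
        using mult_left_mono[OF g'(2)[of u] abs_ge_zero[of h]] by (simp add: mult.commute)
    qed
  qed auto
  then show ?thesis by simp
qed

text \<open>
  On the equilibrium, \<open>a = (1 + z \<bullet> x'') / |z|\<^sup>3\<close>. Near collision the numerator is close to 1, and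
  since the source moves with speed at most \<open>B\<close> the distance \<open>|z|\<close> remains of order \<open>\<delta>\<close> for a time
  \<open>\<delta>\<close>. So \<open>a\<close> is of order \<open>\<delta>\<^sup>-\<^sup>3\<close> there, which exceeds \<open>(R / \<delta>)\<^sup>2\<close> for small \<open>\<delta>\<close> whatever \<open>R\<close> is.
  A phase speed of \<open>R / \<delta>\<close> during a time \<open>\<delta>\<close> is a rotation by \<open>R\<close>.
\<close>
lemma linear_coeff_near_collision:
  assumes I: "open I" "0 \<in> I"
    and arc: "\<And>s. s \<in> I \<Longrightarrow> norm (vector_derivative (\<lambda>s. x s l) (at s)) = 1"
    and Cx: "C2_bounded_on I (\<lambda>s. x s l) B" and Cy: "C2_bounded_on UNIV (\<lambda>t. y t l) B"
    and sep: "\<And>s t. s \<in> I \<Longrightarrow> norm (separation x y s t l) > 0"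
    and equilibrium: "\<And>t. deriv (\<lambda>s. potential x y s t l) 0 = 0"
    and \<delta>: "\<delta> = norm (separation x y 0 0 l)"
    and R: "R \<ge> 1" "2 * R\<^sup>2 * (1 + B) ^ 3 * \<delta> \<le> 1"
    and t: "t \<in> {0..\<delta>}"
  shows "linear_coeff x y t l \<ge> (R / \<delta>)\<^sup>2"
proof -
  obtain x' x'' where x': "\<And>s. s \<in> I \<Longrightarrow> ((\<lambda>s. x s l) has_vector_derivative x' s) (at s)"
      "\<And>s. s \<in> I \<Longrightarrow> (x' has_vector_derivative x'' s) (at s)" "\<And>s. s \<in> I \<Longrightarrow> norm (x'' s) \<le> B"
    using Cx unfolding C2_bounded_on_def by blast
  define z where "z = separation x y 0 t l"
  have unit: "x' 0 \<bullet> x' 0 = 1"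
    using arc[OF I(2)] vector_derivative_at[OF x'(1)[OF I(2)]] by (simp add: dot_square_norm)
  have a: "linear_coeff x y t l = (1 + z \<bullet> x'' 0) / norm z ^ 3"
    unfolding linear_coeff_def potential_def separation_def z_def
    using inverse_distance_derivatives[OF I x'(1,2), of "y t l"] sep[of _ t] equilibrium[of t] unit
    by (simp add: potential_def separation_def)
  have "B \<ge> 0" using x'(3)[OF I(2)] norm_ge_zero order_trans by blast
  have "\<delta> > 0" using sep[OF I(2), of 0] by (simp add: \<delta>)
  \<comment> \<open>While \<open>t\<close> is at most \<open>\<delta>\<close>, the distance to \<open>x 0 l\<close> stays below \<open>\<rho>\<close>.\<close>
  define \<rho> where "\<rho> = (1 + B) * \<delta>"
  have "norm z \<le> \<rho>"
  proof -
    have "z = separation x y 0 0 l - (y t l - y 0 l)" by (simp add: z_def separation_def)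
    then have "norm z \<le> \<delta> + norm (y t l - y 0 l)"
      unfolding \<delta> by (metis norm_triangle_ineq4)
    also have "\<dots> \<le> \<delta> + B * \<delta>"
      using C2_bounded_on_Lipschitz[OF Cy, of t 0] t mult_left_mono[of t \<delta> B] \<open>B \<ge> 0\<close> by auto
    finally show ?thesis by (simp add: \<rho>_def algebra_simps)
  qed
  have z_pos: "norm z > 0" using sep[OF I(2)] by (simp add: z_def)
  have "2 * (B * \<rho>) \<le> 1"
  proof -
    have "2 * (B * \<rho>) = 2 * 1 * ((1 + B) * B) * \<delta>" by (simp add: \<rho>_def)
    also have "\<dots> \<le> 2 * R\<^sup>2 * ((1 + B) * (1 + B)\<^sup>2) * \<delta>"
    proof (intro mult_right_mono mult_mono[of "2 * 1" "2 * R\<^sup>2"] mult_left_mono)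
      show "1 \<le> R\<^sup>2" by (rule one_le_power[OF R(1)])
      show "B \<le> (1 + B)\<^sup>2" using \<open>B \<ge> 0\<close> by (simp add: power2_eq_square algebra_simps)
    qed (use \<open>B \<ge> 0\<close> \<open>\<delta> > 0\<close> in auto)
    also have "\<dots> = 2 * R\<^sup>2 * (1 + B) ^ 3 * \<delta>" by (simp add: power3_eq_cube power2_eq_square mult_ac)
    finally show ?thesis using R(2) by simp
  qed
  moreover have "\<bar>z \<bullet> x'' 0\<bar> \<le> B * \<rho>"
  proof -
    have "\<bar>z \<bullet> x'' 0\<bar> \<le> norm z * norm (x'' 0)" by (rule Cauchy_Schwarz_ineq2)
    also have "\<dots> \<le> \<rho> * B"
      using \<open>norm z \<le> \<rho>\<close> x'(3)[OF I(2)] z_pos by (intro mult_mono) (auto intro: order_trans[OF norm_ge_zero])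
    finally show ?thesis by (simp add: mult.commute)
  qed
  ultimately have num: "1 + z \<bullet> x'' 0 \<ge> 1 / 2" by linarith
  have "(R / \<delta>)\<^sup>2 \<le> (1 / 2) / \<rho> ^ 3"
  proof -
    have "(R / \<delta>)\<^sup>2 * (b * \<delta>) ^ 3 = R\<^sup>2 * b ^ 3 * \<delta>" for b
    proof -
      have "(b * \<delta>) ^ 3 = b ^ 3 * (\<delta>\<^sup>2 * \<delta>)"
        by (simp add: power_mult_distrib power3_eq_cube power2_eq_square)
      then show ?thesis using \<open>\<delta> > 0\<close> by (simp add: power_divide)
    qed
    then have "(R / \<delta>)\<^sup>2 * \<rho> ^ 3 = R\<^sup>2 * (1 + B) ^ 3 * \<delta>"
      unfolding \<rho>_def .
    also have "\<dots> \<le> 1 / 2" using R(2) by simp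
    finally have "(R / \<delta>)\<^sup>2 * \<rho> ^ 3 \<le> 1 / 2" .
    moreover have "\<rho> ^ 3 > 0"
      using z_pos \<open>norm z \<le> \<rho>\<close> by (intro zero_less_power) linarith
    ultimately show ?thesis by (simp only: pos_le_divide_eq)
  qed
  also have "\<dots> \<le> (1 + z \<bullet> x'' 0) / norm z ^ 3"
    using num z_pos power_mono[OF \<open>norm z \<le> \<rho>\<close>, of 3] by (intro frac_le zero_less_power) linarith+
  finally show ?thesis by (simp add: a)
qed

lemma min_distance_le:
  assumes "s \<in> I"
  shows "min_distance I x y l \<le> norm (separation x y s t l)"
proof -
  have "bdd_below ((\<lambda>(s, t). norm (separation x y s t l)) ` (I \<times> UNIV))"
    by (rule bdd_belowI[of _ 0]) auto
  from cINF_lower[OF this, of "(s, t)"] assms show ?thesis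
    by (simp add: min_distance_def)
qed

section \<open>Stability windows accumulate at collision\<close>

theorem theorem1:
  fixes x y :: "real \<Rightarrow> real \<Rightarrow> real^3" and l0 :: real and I :: "real set"
  assumes l0_pos: "l0 > 0"
    and interval: "open I" "is_interval I" "0 \<in> I"
    and arc_length: "\<And>s l. s \<in> I \<Longrightarrow> l \<in> {0..l0} \<Longrightarrow>
          norm (vector_derivative (\<lambda>s. x s l) (at s)) = 1"
    and periodic: "\<And>t l. l \<in> {0..l0} \<Longrightarrow> y (t + 1) l = y t l"
    and min_at_0: "\<And>l. l \<in> {0..l0} \<Longrightarrow> norm (separation x y 0 0 l) = min_distance I x y l"
    and min_pos: "\<And>l. l \<in> {0<..l0} \<Longrightarrow> min_distance I x y l > 0"
    and nondegenerate: "\<And>l. l \<in> {0<..l0} \<Longrightarrow>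
          (deriv ^^ 2) (\<lambda>t. norm (separation x y 0 t l)) 0 \<noteq> 0"
    and orthogonal: "\<And>l. l \<in> {0..l0} \<Longrightarrow>
          vector_derivative (\<lambda>s. x s l) (at 0) \<bullet> vector_derivative (\<lambda>t. y t l) (at 0) = 0"
    and C2_x: "\<exists>B. \<forall>l\<in>{0..l0}. C2_bounded_on I (\<lambda>s. x s l) B"
    and C2_y: "\<exists>B. \<forall>l\<in>{0..l0}. C2_bounded_on UNIV (\<lambda>t. y t l) B"
    and min_to_0: "(min_distance I x y \<longlongrightarrow> 0) (at_right 0)"
    and equilibrium: "\<And>t l. l \<in> {0<..l0} \<Longrightarrow> deriv (\<lambda>s. potential x y s t l) 0 = 0"
    and continuous_coeff: "continuous_on (UNIV \<times> {0<..l0}) (\<lambda>(t, l). linear_coeff x y t l)"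
  shows "\<exists>L :: nat \<Rightarrow> real.
      (\<forall>n\<ge>1. L n \<in> {0<..l0}) \<and>
      (\<forall>n\<ge>1. L (2*n - 1) > L (2*n) \<and> L (2*n) \<ge> L (2*n + 1)) \<and>
      L \<longlonglongrightarrow> 0 \<and>
      (\<forall>n\<ge>1. \<forall>l\<in>{L (2*n)<..<L (2*n - 1)}. strongly_stable (\<lambda>t. linear_coeff x y t l)) \<and>
      (\<forall>n\<ge>1. \<exists>l\<in>{L (2*n + 1)..L (2*n)}.
         \<not> strongly_stable (\<lambda>t. linear_coeff x y t l) \<and>
         (hyperbolic (\<lambda>t. linear_coeff x y t l) \<or> parabolic (\<lambda>t. linear_coeff x y t l)))"
proof -
  obtain Bx By where Bxy: "\<And>l. l \<in> {0..l0} \<Longrightarrow> C2_bounded_on I (\<lambda>s. x s l) Bx"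
      "\<And>l. l \<in> {0..l0} \<Longrightarrow> C2_bounded_on UNIV (\<lambda>t. y t l) By"
    using C2_x C2_y by blast
  define B where "B = max 0 (max Bx By)"
  have B: "C2_bounded_on I (\<lambda>s. x s l) B" "C2_bounded_on UNIV (\<lambda>t. y t l) B" if "l \<in> {0..l0}" for l
    using Bxy[OF that] by (auto intro: C2_bounded_on_mono simp: B_def)
  define Bad where "Bad p \<longleftrightarrow>
    parabolic (\<lambda>t. linear_coeff x y t p) \<and> \<not> strongly_stable (\<lambda>t. linear_coeff x y t p)" for p
  have window: "\<exists>p q. 0 < p \<and> p < q \<and> q \<le> e \<and> Bad p \<and>
      (\<forall>l\<in>{p<..<q}. strongly_stable (\<lambda>t. linear_coeff x y t l))" if e: "0 < e" "e \<le> l0" for e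
  proof -
    have "continuous_on {0..1} (\<lambda>t. linear_coeff x y t e)"
      by (rule continuous_on_compose2[OF continuous_coeff, of _ "\<lambda>t. (t, e)", simplified])
         (use e in \<open>auto intro!: continuous_intros\<close>)
    from compact_imp_bounded[OF compact_continuous_image[OF this compact_Icc]]
    obtain K where "\<forall>v\<in>(\<lambda>t. linear_coeff x y t e) ` {0..1}. norm v \<le> K"
      unfolding bounded_iff by blast
    then have K: "\<bar>linear_coeff x y t e\<bar> \<le> K" if "t \<in> {0..1}" for t
      using that by auto
    have "K \<ge> 0" using K[of 0] by auto
    \<comment> \<open>The amount of rotation that \<open>stable_window\<close> asks for: it depends on \<open>e\<close> alone, so \<open>c\<close> can be
      chosen afterwards, and close enough to collision to produce it.\<close>
    define R where "R = K + 1 + 7 / 2 * pi"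
    have "R \<ge> 1" using \<open>K \<ge> 0\<close> pi_gt_zero by (simp add: R_def)
    have "B \<ge> 0" by (simp add: B_def)
    have pos: "1 / (2 * R\<^sup>2 * (1 + B) ^ 3) > 0" using \<open>R \<ge> 1\<close> \<open>B \<ge> 0\<close> by simp
    have "eventually (\<lambda>c. min_distance I x y c < 1 / (2 * R\<^sup>2 * (1 + B) ^ 3)) (at_right 0)"
      by (rule order_tendstoD(2)[OF min_to_0 pos])
    moreover have "eventually (\<lambda>c. c \<in> {0<..<e}) (at_right 0)"
      using e(1) by (rule eventually_at_right_real)
    ultimately have "eventually (\<lambda>c. c \<in> {0<..<e} \<and>
        min_distance I x y c < 1 / (2 * R\<^sup>2 * (1 + B) ^ 3)) (at_right 0)"
      by eventually_elim simp
    then obtain c where c: "0 < c" "c < e" "min_distance I x y c < 1 / (2 * R\<^sup>2 * (1 + B) ^ 3)"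
      using eventually_happens'[OF trivial_limit_at_right_real] by auto
    define \<delta> where "\<delta> = min_distance I x y c"
    have c_in: "c \<in> {0<..l0}" "c \<in> {0..l0}" using c e by auto
    have "\<delta> > 0" using min_pos[OF c_in(1)] by (simp add: \<delta>_def)
    have small: "2 * R\<^sup>2 * (1 + B) ^ 3 * \<delta> \<le> 1"
      using c(3) pos \<open>R \<ge> 1\<close> \<open>B \<ge> 0\<close> by (simp add: \<delta>_def field_simps)
    have "1 \<le> 2 * R\<^sup>2 * (1 + B) ^ 3"
    proof -
      have "1 * 1 \<le> R\<^sup>2 * (1 + B) ^ 3"
        using \<open>R \<ge> 1\<close> \<open>B \<ge> 0\<close> by (intro mult_mono one_le_power) auto
      then show ?thesis by simp
    qed
    then have "1 * \<delta> \<le> 2 * R\<^sup>2 * (1 + B) ^ 3 * \<delta>"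
      using \<open>\<delta> > 0\<close> by (intro mult_right_mono) auto
    with small have "\<delta> \<le> 1" by simp
    have lower: "linear_coeff x y t c \<ge> (R / \<delta>)\<^sup>2" if "t \<in> {0..\<delta>}" for t
    proof (rule linear_coeff_near_collision[OF interval(1,3) arc_length B _ equilibrium _ \<open>R \<ge> 1\<close> small that])
      show "\<delta> = norm (separation x y 0 0 c)" using min_at_0[OF c_in(2)] by (simp add: \<delta>_def)
      show "norm (separation x y s t c) > 0" if "s \<in> I" for s t
        using min_distance_le[OF that, of x y c t] min_pos[OF c_in(1)] by linarith
    qed (use c_in in auto)
    have cont: "continuous_on ({0..1} \<times> {c..e}) (\<lambda>(t, l). linear_coeff x y t l)"
      by (rule continuous_on_subset[OF continuous_coeff]) (use c e in auto)
    obtain p q where "c \<le> p" "p < q" "q \<le> e" "Bad p"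
      "\<And>l. l \<in> {p<..<q} \<Longrightarrow> strongly_stable (\<lambda>t. linear_coeff x y t l)"
    proof (rule stable_window[OF cont _ _ \<open>K \<ge> 0\<close> _ \<open>\<delta> \<le> 1\<close> _ lower])
      show "K + 1 + 7 / 2 * pi \<le> R / \<delta> * \<delta>" using \<open>\<delta> > 0\<close> by (simp add: R_def)
      show "linear_coeff x y t e \<le> K" if "t \<in> {0..1}" for t using K[OF that] by simp
    qed (use c \<open>\<delta> > 0\<close> \<open>R \<ge> 1\<close> in \<open>auto simp: Bad_def\<close>)
    with c(1) show ?thesis by (intro exI[of _ p] exI[of _ q]) auto
  qed
  from alternating_sequence[where Bad = Bad, OF l0_pos window]
  obtain L where L: "\<forall>n\<ge>1. L n \<in> {0<..l0}"
      "\<forall>n\<ge>1. L (2*n - 1) > L (2*n) \<and> L (2*n) \<ge> L (2*n + 1)" "L \<longlonglongrightarrow> 0"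
      "\<forall>n\<ge>1. \<forall>l\<in>{L (2*n)<..<L (2*n - 1)}. strongly_stable (\<lambda>t. linear_coeff x y t l)"
      "\<forall>n\<ge>1. Bad (L (2*n))"
    by blast
  have "\<forall>n\<ge>1. \<exists>l\<in>{L (2*n + 1)..L (2*n)}. \<not> strongly_stable (\<lambda>t. linear_coeff x y t l) \<and>
      (hyperbolic (\<lambda>t. linear_coeff x y t l) \<or> parabolic (\<lambda>t. linear_coeff x y t l))"
  proof (intro allI impI)
    fix n :: nat assume "n \<ge> 1"
    with L(2,5) show "\<exists>l\<in>{L (2*n + 1)..L (2*n)}. \<not> strongly_stable (\<lambda>t. linear_coeff x y t l) \<and>
        (hyperbolic (\<lambda>t. linear_coeff x y t l) \<or> parabolic (\<lambda>t. linear_coeff x y t l))"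
      by (intro bexI[of _ "L (2*n)"]) (auto simp: Bad_def)
  qed
  with L(1-4) show ?thesis by (intro exI[of _ L] conjI)
qed

end
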